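(* Let $p=p_n$ satisfy $n>1+p$ for all $n\geq3$ and $\lim_{n\to\infty}p/n=y\in(0,1]$. Let $\mathbf{x}_1,\dots,\mathbf{x}_n$ be i.i.d. $N_p(\boldsymbol\mu,\boldsymbol\Sigma)$, $\bar{\mathbf{x}}=\frac1n\sum_{i=1}^n\mathbf{x}_i$, $\mathbf{A}=\sum_{i=1}^n(\mathbf{x}_i-\bar{\mathbf{x}})(\mathbf{x}_i-\bar{\mathbf{x}})'$, and $$\Lambda_n=\Big(\frac en\Big)^{np/2}|\mathbf{A}|^{n/2}e^{-\operatorname{tr}(\mathbf{A})/2}e^{-n\bar{\mathbf{x}}'\bar{\mathbf{x}}/2}.$$ Assume $H_0:\boldsymbol\mu=\mathbf{0}$ and $\boldsymbol\Sigma=\mathbf{I}_p$. Then $(\log\Lambda_n-\mu_n)/(n\sigma_n)$ converges in distribution to $N(0,1)$ as $n\to\infty$, where $$\mu_n=-\frac14\Big[n(2n-2p-3)\log\Big(1-\frac p{n-1}\Big)+2(n+1)p\Big],\qquad \sigma_n^2=-\frac12\Big(\frac p{n-1}+\log\Big(1-\frac p{n-1}\Big)\Big)>0.$$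
   Context: $|\cdot|$ denotes the determinant; $\Lambda_n$ is the likelihood ratio statistic for testing $\boldsymbol\mu=\mathbf 0,\boldsymbol\Sigma=\mathbf I_p$. *)

theory Defs
  imports "HOL-Probability.Probability" "Jordan_Normal_Form.Determinant"
begin

text \<open>A sample is a function x with x i j = j-th coordinate of observation i
  (i < n, j < p).\<close>

definition sample_mean :: "nat \<Rightarrow> (nat \<Rightarrow> nat \<Rightarrow> real) \<Rightarrow> nat \<Rightarrow> real" where
  "sample_mean n x j = (\<Sum>i<n. x i j) / real n"

definition scatter_mat :: "nat \<Rightarrow> nat \<Rightarrow> (nat \<Rightarrow> nat \<Rightarrow> real) \<Rightarrow> real mat" where
  "scatter_mat n p x = mat p p (\<lambda>(j, k). \<Sum>i<n.
      (x i j - sample_mean n x j) * (x i k - sample_mean n x k))"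

definition mat_trace :: "nat \<Rightarrow> real mat \<Rightarrow> real" where
  "mat_trace p A = (\<Sum>j<p. A $$ (j, j))"

text \<open>Likelihood ratio statistic for H0: mu = 0, Sigma = I_p.\<close>
definition LR_stat :: "nat \<Rightarrow> nat \<Rightarrow> (nat \<Rightarrow> nat \<Rightarrow> real) \<Rightarrow> real" where
  "LR_stat n p x =
     (exp 1 / real n) powr (real n * real p / 2)
     * det (scatter_mat n p x) powr (real n / 2)
     * exp (- mat_trace p (scatter_mat n p x) / 2)
     * exp (- real n * (\<Sum>j<p. (sample_mean n x j)\<^sup>2) / 2)"

definition mu_LR :: "nat \<Rightarrow> nat \<Rightarrow> real" where
  "mu_LR n p = - 1/4 * (real n * (2 * real n - 2 * real p - 3)
       * ln (1 - real p / (real n - 1)) + 2 * (real n + 1) * real p)"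

definition sigma2_LR :: "nat \<Rightarrow> nat \<Rightarrow> real" where
  "sigma2_LR n p = - 1/2 * (real p / (real n - 1) + ln (1 - real p / (real n - 1)))"

end

theory Submission
  imports Defs "HOL-Real_Asymp.Real_Asymp"
begin

text \<open>
  Since \<open>tr A + n |mean|\<^sup>2\<close> is the sum of all squared observations, \<open>ln \<Lambda>\<^sub>n\<close> is a constant plus
  \<open>n/2 * ln |A|\<close> minus half that sum, and \<open>n |A|\<close> is the Gram determinant of the constant
  vector 1 and the \<open>p\<close> data columns. Appending a column multiplies a Gram determinant by the
  squared distance of the column to the span of the previous \<open>d\<close> ones, which by rotation invariance
  of the Gaussian measure is distributed as a sum of \<open>n - d\<close> squares, jointly with the norm of the
  column. Hence the characteristic function of \<open>ln \<Lambda>\<^sub>n\<close> is an explicit product of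
  complex Gamma quotients. Its logarithm is expanded to second order at 0: the third derivative is
  controlled by the tetragamma function, the first two derivatives are digamma and trigamma sums that
  telescope up to errors \<open>O(1 / (n - 1 - p))\<close>, and all errors vanish after scaling because
  \<open>(n - 1 - p) \<sigma>\<^sub>n\<close> tends to infinity. Levy's continuity theorem concludes.
\<close>

section \<open>Rotation invariance of the Gaussian product measure\<close>

text \<open>The obstacle is y = 1. Then n - 1 - p may stay bounded, so the Gamma arguments (n - d) /
  2 do not all tend to infinity and the factors cannot be treated one by one through their
  asymptotics. But p + 1 < n keeps every argument at least 1, so polygamma estimates valid from 1 on
  can be summed over d. Each error is bounded by a multiple of 1 / (m - 1) - 1 / m with m = n - d,
  so the total error depends on the last codimension only. If y < 1, that codimension grows linearly
  while sigma stays away from 0; if y = 1, it is only known to be at least 1, but the logarithm in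
  \<open>sigma2_LR\<close> diverges and sigma grows instead. Determinant and sum of squares are
  dependent, so they are transformed jointly: for an argument u, the factor n / 2 in front of ln |A|
  makes the determinant appear with the imaginary exponent v = u * n / 2, while half the sum of
  squares appears with u itself. With u = t / (n * sigma), the errors in drift, variance and third
  derivative all carry the common factor 1 / ((n - 1 - p) * sigma).\<close>

definition rot :: "nat \<Rightarrow> nat \<Rightarrow> real \<Rightarrow> real \<Rightarrow> (nat \<Rightarrow> real) \<Rightarrow> nat \<Rightarrow> real" where
  "rot a b c s x = x(a := c * x a + s * x b, b := c * x b - s * x a)"

text \<open>For c different from 0 the rotation is a composition of two one-variable affine
  substitutions, u = c * x + s * y for fixed y and then a substitution in y for fixed u. Their
  Jacobians \<open>\<bar>c\<bar>\<close> and its inverse cancel. For c = 0 it is a swap of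
  coordinates with signs.\<close>

lemma nn_integral_lborel_rotation:
  fixes g :: "real \<Rightarrow> real \<Rightarrow> ennreal"
  assumes [measurable]: "case_prod g \<in> borel_measurable (borel \<Otimes>\<^sub>M borel)"
    and cs: "c\<^sup>2 + s\<^sup>2 = 1"
  shows "(\<integral>\<^sup>+x. \<integral>\<^sup>+y. g (c * x + s * y) (c * y - s * x) \<partial>lborel \<partial>lborel)
       = (\<integral>\<^sup>+x. \<integral>\<^sup>+y. g x y \<partial>lborel \<partial>lborel)"
proof (cases "c = 0")
  case True
  then have "s \<noteq> 0" "\<bar>s\<bar> = 1"
    using cs by (auto simp: power2_eq_1_iff)
  have "(\<integral>\<^sup>+x. \<integral>\<^sup>+y. g (c * x + s * y) (c * y - s * x) \<partial>lborel \<partial>lborel)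
      = (\<integral>\<^sup>+x. \<integral>\<^sup>+y. g y (- s * x) \<partial>lborel \<partial>lborel)"
    by (subst (2) nn_integral_real_affine[where c = s and t = 0])
       (use True \<open>s \<noteq> 0\<close> \<open>\<bar>s\<bar> = 1\<close> in auto)
  also have "\<dots> = (\<integral>\<^sup>+x. \<integral>\<^sup>+y. g y x \<partial>lborel \<partial>lborel)"
    by (subst (2) nn_integral_real_affine[where c = "-s" and t = 0])
       (use \<open>s \<noteq> 0\<close> \<open>\<bar>s\<bar> = 1\<close> in auto)
  also have "\<dots> = (\<integral>\<^sup>+x. \<integral>\<^sup>+y. g x y \<partial>lborel \<partial>lborel)"
    by (rule lborel_pair.Fubini') simp
  finally show ?thesis .
next
  case False
  \<comment> \<open>After x is eliminated through u, the second coordinate is an affine function of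
    y with slope 1 / c; this is where c^2 + s^2 = 1 enters.\<close>
  have *: "c * y - s * ((u - s * y) / c) = (y - s * u) / c" for y u
  proof -
    have "c * y - s * ((u - s * y) / c) = ((c\<^sup>2 + s\<^sup>2) * y - s * u) / c"
      using False by (simp add: field_simps power2_eq_square)
    then show ?thesis using cs by simp
  qed
  have "(\<integral>\<^sup>+x. \<integral>\<^sup>+y. g (c * x + s * y) (c * y - s * x) \<partial>lborel \<partial>lborel)
      = (\<integral>\<^sup>+y. \<integral>\<^sup>+x. g (c * x + s * y) (c * y - s * x) \<partial>lborel \<partial>lborel)"
    by (rule lborel_pair.Fubini') simp
  also have "\<dots> = (\<integral>\<^sup>+y. \<integral>\<^sup>+u. g u ((y - s * u) / c) / ennreal \<bar>c\<bar> \<partial>lborel \<partial>lborel)"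
  proof (rule nn_integral_cong)
    fix y :: real
    have "(\<integral>\<^sup>+u. g u ((y - s * u) / c) / ennreal \<bar>c\<bar> \<partial>lborel)
        = ennreal \<bar>c\<bar> * (\<integral>\<^sup>+x. g (c * x + s * y) ((y - s * (c * x + s * y)) / c) / ennreal \<bar>c\<bar> \<partial>lborel)"
      using False
      by (subst nn_integral_real_affine[where c = c and t = "s * y"]) (auto simp: add.commute)
    also have "\<dots> = (\<integral>\<^sup>+x. g (c * x + s * y) ((y - s * (c * x + s * y)) / c) \<partial>lborel)"
      using False by (subst nn_integral_divide) (auto simp: ennreal_mult_divide_eq ennreal_times_divide mult.commute[of "ennreal \<bar>c\<bar>"])
    also have "\<dots> = (\<integral>\<^sup>+x. g (c * x + s * y) (c * y - s * x) \<partial>lborel)"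
      using False by (intro nn_integral_cong) (simp add: *[symmetric])
    finally show "(\<integral>\<^sup>+x. g (c * x + s * y) (c * y - s * x) \<partial>lborel)
        = (\<integral>\<^sup>+u. g u ((y - s * u) / c) / ennreal \<bar>c\<bar> \<partial>lborel)" ..
  qed
  also have "\<dots> = (\<integral>\<^sup>+u. \<integral>\<^sup>+y. g u ((y - s * u) / c) / ennreal \<bar>c\<bar> \<partial>lborel \<partial>lborel)"
    by (rule lborel_pair.Fubini') simp
  also have "\<dots> = (\<integral>\<^sup>+u. \<integral>\<^sup>+v. g u v \<partial>lborel \<partial>lborel)"
  proof (rule nn_integral_cong)
    fix u :: real
    have "(\<integral>\<^sup>+y. g u ((y - s * u) / c) / ennreal \<bar>c\<bar> \<partial>lborel)
        = ennreal \<bar>c\<bar> * (\<integral>\<^sup>+v. g u v / ennreal \<bar>c\<bar> \<partial>lborel)"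
      using False
      by (subst nn_integral_real_affine[where c = c and t = "s * u"]) auto
    also have "\<dots> = (\<integral>\<^sup>+v. g u v \<partial>lborel)"
      using False by (subst nn_integral_divide) (auto simp: ennreal_mult_divide_eq ennreal_times_divide mult.commute[of "ennreal \<bar>c\<bar>"])
    finally show "(\<integral>\<^sup>+y. g u ((y - s * u) / c) / ennreal \<bar>c\<bar> \<partial>lborel) = (\<integral>\<^sup>+v. g u v \<partial>lborel)" .
  qed
  finally show ?thesis .
qed

abbreviation gauss :: "'i set \<Rightarrow> ('i \<Rightarrow> real) measure" where
  "gauss I \<equiv> \<Pi>\<^sub>M i\<in>I. std_normal_distribution"

text \<open>The joint density depends on x^2 + y^2 only, so it can be carried along as a factor of
  the integrand in the Lebesgue case.\<close>

lemma nn_integral_std_normal_rotation: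
  fixes g :: "real \<Rightarrow> real \<Rightarrow> ennreal"
  assumes [measurable]: "case_prod g \<in> borel_measurable (borel \<Otimes>\<^sub>M borel)"
    and cs: "c\<^sup>2 + s\<^sup>2 = 1"
  shows "(\<integral>\<^sup>+x. \<integral>\<^sup>+y. g (c * x + s * y) (c * y - s * x) \<partial>std_normal_distribution \<partial>std_normal_distribution)
       = (\<integral>\<^sup>+x. \<integral>\<^sup>+y. g x y \<partial>std_normal_distribution \<partial>std_normal_distribution)"
proof -
  let ?\<phi> = "\<lambda>x. ennreal (std_normal_density x)"
  have density: "(\<integral>\<^sup>+x. \<integral>\<^sup>+y. G x y \<partial>std_normal_distribution \<partial>std_normal_distribution)
      = (\<integral>\<^sup>+x. \<integral>\<^sup>+y. ?\<phi> x * ?\<phi> y * G x y \<partial>lborel \<partial>lborel)"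
    if [measurable]: "case_prod G \<in> borel_measurable (borel \<Otimes>\<^sub>M borel)" for G :: "real \<Rightarrow> real \<Rightarrow> ennreal"
    by (simp add: nn_integral_density nn_integral_cmult mult.assoc)
  have \<phi>: "?\<phi> (c * x + s * y) * ?\<phi> (c * y - s * x) = ?\<phi> x * ?\<phi> y" for x y
  proof -
    have "(c * x + s * y)\<^sup>2 + (c * y - s * x)\<^sup>2 = (c\<^sup>2 + s\<^sup>2) * (x\<^sup>2 + y\<^sup>2)"
      by (simp add: power2_eq_square algebra_simps)
    then have "- (c * x + s * y)\<^sup>2 / 2 + - (c * y - s * x)\<^sup>2 / 2 = - x\<^sup>2 / 2 + - y\<^sup>2 / 2"
      using cs by simp
    then have "exp (- (c * x + s * y)\<^sup>2 / 2) * exp (- (c * y - s * x)\<^sup>2 / 2)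
             = exp (- x\<^sup>2 / 2) * exp (- y\<^sup>2 / 2)"
      by (simp only: exp_add[symmetric])
    then show ?thesis
      by (simp add: std_normal_density_def ennreal_mult'[symmetric])
  qed
  have "(\<integral>\<^sup>+x. \<integral>\<^sup>+y. g (c * x + s * y) (c * y - s * x) \<partial>std_normal_distribution \<partial>std_normal_distribution)
      = (\<integral>\<^sup>+x. \<integral>\<^sup>+y. ?\<phi> x * ?\<phi> y * g (c * x + s * y) (c * y - s * x) \<partial>lborel \<partial>lborel)"
    by (rule density) simp
  also have "\<dots> = (\<integral>\<^sup>+x. \<integral>\<^sup>+y. ?\<phi> x * ?\<phi> y * g x y \<partial>lborel \<partial>lborel)"
    using nn_integral_lborel_rotation[of "\<lambda>x y. ?\<phi> x * ?\<phi> y * g x y", OF _ cs] by (simp add: \<phi>)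
  also have "\<dots> = (\<integral>\<^sup>+x. \<integral>\<^sup>+y. g x y \<partial>std_normal_distribution \<partial>std_normal_distribution)"
    by (rule density[symmetric]) simp
  finally show ?thesis .
qed

lemma prob_space_gauss: "prob_space (gauss I)"
  by (intro prob_space_PiM prob_space_normal_density) simp

lemma measurable_rot [measurable]:
  assumes "a \<in> I" "b \<in> I"
  shows "rot a b c s \<in> measurable (gauss I) (gauss I)"
proof (rule measurable_PiM_single')
  fix i assume "i \<in> I"
  have comp [measurable]: "(\<lambda>x. x k) \<in> borel_measurable (gauss I)" if "k \<in> I" for k
    using measurable_component_singleton[OF that, of "\<lambda>_. std_normal_distribution"] by simp
  show "(\<lambda>x. rot a b c s x i) \<in> measurable (gauss I) std_normal_distribution"
    using assms \<open>i \<in> I\<close> by (cases "i = b"; cases "i = a") (simp_all add: rot_def)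
next
  show "rot a b c s \<in> space (gauss I) \<rightarrow> (\<Pi>\<^sub>E i\<in>I. space std_normal_distribution)"
    using assms by (auto simp: space_PiM rot_def PiE_def extensional_def)
qed

text \<open>Fubini isolates the two coordinates that move, which leaves the planar case. Rotations
  of coordinate planes are enough for the application, since they already triangularise
  matrices.\<close>

lemma distr_gauss_rot:
  assumes "finite I" "a \<in> I" "b \<in> I" "a \<noteq> b" "c\<^sup>2 + s\<^sup>2 = 1"
  shows "distr (gauss I) (gauss I) (rot a b c s) = gauss I"
proof (rule measure_eqI)
  fix A assume "A \<in> sets (distr (gauss I) (gauss I) (rot a b c s))"
  then have [measurable]: "A \<in> sets (gauss I)" by simp
  interpret product_sigma_finite "\<lambda>_. std_normal_distribution"
    by (simp add: product_sigma_finite_def prob_space_normal_density prob_space_imp_sigma_finite)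
  define K where "K = I - {a, b}"
  have K: "finite K" "b \<notin> K" "a \<notin> insert b K" "I = insert a (insert b K)"
    using assms by (auto simp: K_def)
  have split: "(\<integral>\<^sup>+x. F x \<partial>gauss I)
      = (\<integral>\<^sup>+x. \<integral>\<^sup>+u. \<integral>\<^sup>+v. F (x(b := u, a := v)) \<partial>std_normal_distribution \<partial>std_normal_distribution \<partial>gauss K)"
    if F[measurable]: "F \<in> borel_measurable (gauss I)" for F :: "(nat \<Rightarrow> real) \<Rightarrow> ennreal"
  proof -
    have F'[measurable]: "F \<in> borel_measurable (gauss (insert a (insert b K)))"
      using F by (simp only: K(4))
    have inner: "(\<lambda>x. \<integral>\<^sup>+v. F (x(a := v)) \<partial>std_normal_distribution) \<in> borel_measurable (gauss (insert b K))"
      using measurable_comp[OF measurable_add_dim F']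
      by (intro sigma_finite_measure.borel_measurable_nn_integral)
         (auto simp: prob_space_normal_density prob_space_imp_sigma_finite o_def split_beta')
    show ?thesis
      unfolding K(4)
      using product_nn_integral_insert[OF _ _ F'] product_nn_integral_insert[OF _ _ inner] K(1-3)
      by simp
  qed
  have rotm[measurable]: "rot a b c s \<in> measurable (gauss I) (gauss I)"
    using assms by (intro measurable_rot)
  have "emeasure (distr (gauss I) (gauss I) (rot a b c s)) A
      = (\<integral>\<^sup>+x. indicator A x \<partial>distr (gauss I) (gauss I) (rot a b c s))"
    by simp
  also have "\<dots> = (\<integral>\<^sup>+x. indicator A (rot a b c s x) \<partial>gauss I)"
    by (subst nn_integral_distr) simp_all
  also have "\<dots> = (\<integral>\<^sup>+x. indicator A x \<partial>gauss I)"
  proof -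
    have "(\<integral>\<^sup>+x. \<integral>\<^sup>+u. \<integral>\<^sup>+v. indicator A (rot a b c s (x(b := u, a := v)))
            \<partial>std_normal_distribution \<partial>std_normal_distribution \<partial>gauss K)
        = (\<integral>\<^sup>+x. \<integral>\<^sup>+u. \<integral>\<^sup>+v. indicator A (x(b := u, a := v))
            \<partial>std_normal_distribution \<partial>std_normal_distribution \<partial>gauss K)"
    proof (rule nn_integral_cong)
      fix x assume x: "x \<in> space (gauss K)"
      let ?g = "\<lambda>u v. indicator A (x(b := u, a := v)) :: ennreal"
      have upd: "(\<lambda>(u, v). x(b := u, a := v)) \<in> measurable (borel \<Otimes>\<^sub>M borel) (gauss I)"
      proof (rule measurable_PiM_single')
        fix i assume "i \<in> I"
        then show "(\<lambda>w. (case w of (u, v) \<Rightarrow> x(b := u, a := v)) i)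
            \<in> measurable (borel \<Otimes>\<^sub>M borel) std_normal_distribution"
          by (auto simp: fun_upd_def split_beta')
      qed (use x assms K in \<open>auto simp: space_PiM space_pair_measure PiE_iff extensional_def\<close>)
      have g: "case_prod ?g \<in> borel_measurable (borel \<Otimes>\<^sub>M borel)"
        using measurable_comp[OF upd, of "indicator A" "borel :: ennreal measure"]
        by (simp add: o_def split_beta')
      \<comment> \<open>The outer variable u sits at b and the inner variable v at a, so the planar
        rotation appears with -s in place of s.\<close>
      have "rot a b c s (x(b := u, a := v)) = x(b := c * u + (- s) * v, a := c * v - (- s) * u)" for u v
        using \<open>a \<noteq> b\<close> by (auto simp: rot_def fun_eq_iff)
      then show "(\<integral>\<^sup>+u. \<integral>\<^sup>+v. indicator A (rot a b c s (x(b := u, a := v)))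
            \<partial>std_normal_distribution \<partial>std_normal_distribution)
        = (\<integral>\<^sup>+u. \<integral>\<^sup>+v. indicator A (x(b := u, a := v)) \<partial>std_normal_distribution \<partial>std_normal_distribution)"
        using nn_integral_std_normal_rotation[OF g, of c "- s"] assms by simp
    qed
    moreover have "(\<lambda>x. indicator A (rot a b c s x) :: ennreal) \<in> borel_measurable (gauss I)"
      by simp
    ultimately show ?thesis
      using split[of "\<lambda>x. indicator A (rot a b c s x)"] split[of "\<lambda>x. indicator A x"] by simp
  qed
  also have "\<dots> = emeasure (gauss I) A" by simp
  finally show "emeasure (distr (gauss I) (gauss I) (rot a b c s)) A = emeasure (gauss I) A" .
qed simp

section \<open>Gram determinants of Gaussian columns\<close>

text \<open>\<open>Y j i\<close> is entry i of column j. Only inner products of columns enter, so an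
  orthogonal map applied to all columns changes nothing.\<close>

definition gram_det :: "nat \<Rightarrow> nat \<Rightarrow> (nat \<Rightarrow> nat \<Rightarrow> real) \<Rightarrow> real" where
  "gram_det n q Y = det (mat q q (\<lambda>(j, k). \<Sum>i<n. Y j i * Y k i))"

lemma gram_det_cong:
  assumes "\<And>j k. j < q \<Longrightarrow> k < q \<Longrightarrow> (\<Sum>i<n. Y j i * Y k i) = (\<Sum>i<n. Z j i * Z k i)"
  shows "gram_det n q Y = gram_det n q Z"
  unfolding gram_det_def by (intro arg_cong[of _ _ det] eq_matI) (auto simp: assms)

text \<open>All entries in rows q, ..., n - 1 vanish, so the Gram matrix is
  \<open>transpose_mat T * T\<close> for the square triangular top block T.\<close>

lemma gram_det_upper_triangular:
  assumes "q \<le> n" and tri: "\<And>i j. j < q \<Longrightarrow> j < i \<Longrightarrow> i < n \<Longrightarrow> Y j i = 0"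
  shows "gram_det n q Y = (\<Prod>j<q. Y j j)\<^sup>2"
proof -
  define T where "T = mat q q (\<lambda>(i, j). Y j i)"
  have T: "T \<in> carrier_mat q q" by (simp add: T_def)
  have "mat q q (\<lambda>(j, k). \<Sum>i<n. Y j i * Y k i) = transpose_mat T * T"
  proof (rule eq_matI)
    fix j k assume "j < dim_row (transpose_mat T * T)" "k < dim_col (transpose_mat T * T)"
    then have jk: "j < q" "k < q" by (simp_all add: T_def)
    have "(\<Sum>i<n. Y j i * Y k i) = (\<Sum>i<q. Y j i * Y k i)"
      using assms jk by (intro sum.mono_neutral_right) auto
    then show "mat q q (\<lambda>(j, k). \<Sum>i<n. Y j i * Y k i) $$ (j, k) = (transpose_mat T * T) $$ (j, k)"
      using jk by (simp add: T_def scalar_prod_def atLeast0LessThan)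
  qed (simp_all add: T_def)
  moreover have "det T = (\<Prod>j<q. Y j j)"
  proof -
    have "upper_triangular T"
      using assms by (auto simp: T_def)
    then have "det T = prod_list (diag_mat T)"
      by (rule det_upper_triangular[OF _ T])
    then show ?thesis
      by (simp add: diag_mat_def T_def prod.list_conv_set_nth atLeast0LessThan)
  qed
  ultimately show ?thesis
    by (simp add: gram_det_def det_mult[of _ q] det_transpose[OF T] T power2_eq_square)
qed

lemma sum_rot:
  assumes "a < n" "b < n" "a \<noteq> b" "c\<^sup>2 + s\<^sup>2 = 1"
  shows "(\<Sum>i<n. rot a b c s x i * rot a b c s y i) = (\<Sum>i<n. x i * y i)"
proof -
  have split: "(\<Sum>i<n. f i) = f a + f b + (\<Sum>i\<in>{..<n} - {a, b}. f i)" for f :: "nat \<Rightarrow> real"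
    using assms by (subst sum.subset_diff[of "{a, b}"]) auto
  have "rot a b c s x a * rot a b c s y a + rot a b c s x b * rot a b c s y b
      = (c\<^sup>2 + s\<^sup>2) * (x a * y a + x b * y b)"
    using \<open>a \<noteq> b\<close> by (simp add: rot_def power2_eq_square algebra_simps)
  moreover have "(\<Sum>i\<in>{..<n} - {a, b}. rot a b c s x i * rot a b c s y i) = (\<Sum>i\<in>{..<n} - {a, b}. x i * y i)"
    by (intro sum.cong) (auto simp: rot_def)
  ultimately show ?thesis
    using assms by (simp add: split)
qed

lemma measurable_gauss_component:
  "k \<in> I \<Longrightarrow> (\<lambda>x. x k) \<in> borel_measurable (gauss I)"
  using measurable_component_singleton[of k I "\<lambda>_. std_normal_distribution"] by simp

text \<open>The Leibniz expansion makes the determinant a polynomial in the entries.\<close>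

lemma measurable_gram_det:
  assumes "\<And>j i. j < q \<Longrightarrow> i < n \<Longrightarrow> (\<lambda>\<omega>. Y \<omega> j i) \<in> borel_measurable M"
  shows "(\<lambda>\<omega>. gram_det n q (Y \<omega>)) \<in> borel_measurable M"
proof -
  have "(\<lambda>\<omega>. gram_det n q (Y \<omega>))
      = (\<lambda>\<omega>. \<Sum>\<pi>\<in>{\<pi>. \<pi> permutes {0..<q}}. signof \<pi> * (\<Prod>j = 0..<q. \<Sum>i<n. Y \<omega> j i * Y \<omega> (\<pi> j) i))"
    by (auto simp: gram_det_def det_def intro!: ext sum.cong prod.cong)
  moreover have "(\<lambda>\<omega>. \<Sum>i<n. Y \<omega> j i * Y \<omega> (\<pi> j) i) \<in> borel_measurable M"
    if "\<pi> permutes {0..<q}" "j < q" for \<pi> j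
    using that assms by (intro borel_measurable_sum borel_measurable_times)
      (auto dest: permutes_in_image[of _ _ j])
  ultimately show ?thesis
    by (auto intro!: borel_measurable_sum borel_measurable_times borel_measurable_prod)
qed

text \<open>Both sides are invariant under Givens rotations of the columns of \<open>Y\<close>, so \<open>Y\<close> may be assumed upper triangular.\<close>

lemma integral_gram_det_add_column:
  fixes f :: "real \<Rightarrow> real \<Rightarrow> complex"
  assumes f: "case_prod f \<in> borel_measurable (borel \<Otimes>\<^sub>M borel)" and "d < n"
  shows "(\<integral>x. f (gram_det n (Suc d) (\<lambda>j. if j = d then x else Y j)) (\<Sum>i<n. (x i)\<^sup>2) \<partial>gauss {..<n})
       = (\<integral>x. f (gram_det n d Y * (\<Sum>i\<in>{d..<n}. (x i)\<^sup>2)) (\<Sum>i<n. (x i)\<^sup>2) \<partial>gauss {..<n})"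
    (is "?P Y")
proof -
  \<comment> \<open>Rotating the fixed columns is compensated by rotating x as well, which keeps
    both arguments of f; the rotation of x is then absorbed by the invariance of its law.\<close>
  have rotate: "?P Y" if "?P (\<lambda>j. rot a b c s (Y j))" and ab: "a < n" "b < n" "a \<noteq> b" "c\<^sup>2 + s\<^sup>2 = 1"
    for Y a b c s
  proof -
    let ?R = "rot a b c s"
    let ?F = "\<lambda>x. f (gram_det n (Suc d) (\<lambda>j. if j = d then x else ?R (Y j))) (\<Sum>i<n. (x i)\<^sup>2)"
    have F: "?F \<in> borel_measurable (gauss {..<n})"
    proof -
      have "(\<lambda>x. (gram_det n (Suc d) (\<lambda>j. if j = d then x else ?R (Y j)), \<Sum>i<n. (x i)\<^sup>2))
          \<in> measurable (gauss {..<n}) (borel \<Otimes>\<^sub>M borel)"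
      proof (intro measurable_Pair measurable_gram_det borel_measurable_sum borel_measurable_power)
        fix j i assume "i < n"
        then show "(\<lambda>x. (if j = d then x else ?R (Y j)) i) \<in> borel_measurable (gauss {..<n})"
          by (cases "j = d") (auto simp: measurable_gauss_component)
      qed (auto simp: measurable_gauss_component)
      from measurable_comp[OF this f] show ?thesis by (simp add: o_def)
    qed
    have "f (gram_det n (Suc d) (\<lambda>j. if j = d then x else Y j)) (\<Sum>i<n. (x i)\<^sup>2) = ?F (?R x)" for x
    proof -
      have "gram_det n (Suc d) (\<lambda>j. if j = d then x else Y j) = gram_det n (Suc d) (\<lambda>j. if j = d then ?R x else ?R (Y j))"
        by (rule gram_det_cong) (use ab in \<open>auto simp: sum_rot\<close>)
      then show ?thesis
        using sum_rot[OF ab, of x x] by (simp add: power2_eq_square)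
    qed
    then have "(\<integral>x. f (gram_det n (Suc d) (\<lambda>j. if j = d then x else Y j)) (\<Sum>i<n. (x i)\<^sup>2) \<partial>gauss {..<n})
             = (\<integral>x. ?F (?R x) \<partial>gauss {..<n})" by simp
    also have "\<dots> = (\<integral>x. ?F x \<partial>distr (gauss {..<n}) (gauss {..<n}) ?R)"
      using ab F by (intro integral_distr[symmetric] measurable_rot) auto
    also have "\<dots> = (\<integral>x. ?F x \<partial>gauss {..<n})"
      using ab by (subst distr_gauss_rot) auto
    also have "gram_det n d (\<lambda>j. ?R (Y j)) = gram_det n d Y"
      by (rule gram_det_cong) (use ab in \<open>auto simp: sum_rot\<close>)
    ultimately show ?thesis using that(1) by simp
  qed
  have triangular: "?P Y" if tri: "\<And>j i. j < d \<Longrightarrow> j < i \<Longrightarrow> i < n \<Longrightarrow> Y j i = 0" for Y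
  proof -
    have "gram_det n (Suc d) (\<lambda>j. if j = d then x else Y j) = gram_det n d Y * (\<Sum>i\<in>{d..<n}. (x i)\<^sup>2)" for x
    proof -
      let ?r = "sqrt (\<Sum>i\<in>{d..<n}. (x i)\<^sup>2)"
      \<comment> \<open>\<open>z\<close> replaces the part of x in coordinates d, ..., n - 1 by its
        length, placed in coordinate d. The first d columns vanish there, so all inner products
        survive, and with z as last column the family is upper triangular.\<close>
      define z where "z i = (if i < d then x i else if i = d then ?r else 0)" for i
      have split: "(\<Sum>i<n. g i) = (\<Sum>i<d. g i) + (\<Sum>i\<in>{d..<n}. g i)" for g :: "nat \<Rightarrow> real"
        using \<open>d < n\<close> by (simp add: lessThan_atLeast0 sum.atLeastLessThan_concat)
      have 1: "(\<Sum>i<n. Y j i * x i) = (\<Sum>i<n. Y j i * z i)" if "j < d" for j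
        using tri that by (simp add: split z_def)
      have "(\<Sum>i\<in>{d..<n}. z i * z i) = (\<Sum>i\<in>{d}. z i * z i)"
        using \<open>d < n\<close> by (intro sum.mono_neutral_right) (auto simp: z_def)
      also have "\<dots> = (\<Sum>i\<in>{d..<n}. x i * x i)"
        by (simp add: z_def sum_nonneg power2_eq_square[symmetric])
      finally have 2: "(\<Sum>i<n. x i * x i) = (\<Sum>i<n. z i * z i)"
        by (simp add: split z_def)
      have 3: "(\<Sum>i<n. x i * Y j i) = (\<Sum>i<n. z i * Y j i)" if "j < d" for j
        using 1[OF that] by (simp add: mult.commute)
      have "gram_det n (Suc d) (\<lambda>j. if j = d then x else Y j) = gram_det n (Suc d) (\<lambda>j. if j = d then z else Y j)"
        by (rule gram_det_cong) (auto simp: 1 2 3 less_Suc_eq)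
      also have "\<dots> = (\<Prod>j<Suc d. (if j = d then z else Y j) j)\<^sup>2"
        using \<open>d < n\<close> tri by (intro gram_det_upper_triangular) (auto simp: z_def)
      also have "\<dots> = (\<Prod>j<d. Y j j)\<^sup>2 * ?r\<^sup>2"
        by (simp add: z_def power_mult_distrib)
      also have "(\<Prod>j<d. Y j j)\<^sup>2 = gram_det n d Y"
        using \<open>d < n\<close> tri by (intro gram_det_upper_triangular[symmetric]) auto
      finally show ?thesis by (simp add: sum_nonneg)
    qed
    then show ?thesis by simp
  qed
  \<comment> \<open>Descending induction on the number k of columns already in triangular form; k =
    d is the triangular case and k = 0 the claim.\<close>
  have triangularise: "?P Y" if "k \<le> d" and "\<And>j i. j < k \<Longrightarrow> j < i \<Longrightarrow> i < n \<Longrightarrow> Y j i = 0" for k Y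
    using that
  proof (induction arbitrary: Y rule: inc_induct)
    case base
    show ?case by (rule triangular) (use base.prems in auto)
  next
    case (step k)
    \<comment> \<open>Column k is cleared from the top: rows k + 1, ..., l - 1 are already 0. Again
      the induction descends, from l = n.\<close>
    have "?P Y" if "l \<le> n" "k < l" and "\<And>j i. j < k \<Longrightarrow> j < i \<Longrightarrow> i < n \<Longrightarrow> Y j i = 0"
      and "\<And>i. k < i \<Longrightarrow> i < l \<Longrightarrow> Y k i = 0" for l Y
      using that
    proof (induction arbitrary: Y rule: inc_induct)
      case base
      then show ?case
        by (intro step.IH) (auto simp: less_Suc_eq)
    next
      case (step l)
      show ?case
      proof (cases "Y k l = 0")
        case True
        then show ?thesis
          using step.prems by (intro step.IH) (auto simp: less_Suc_eq)
      next
        case False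
        define r where "r = sqrt ((Y k k)\<^sup>2 + (Y k l)\<^sup>2)"
        have r: "r\<^sup>2 = (Y k k)\<^sup>2 + (Y k l)\<^sup>2" "r > 0"
          using False by (simp_all add: r_def sum_power2_gt_zero_iff)
        \<comment> \<open>The Givens coefficients: entry l of column k becomes c * Y k l - s * Y k k
          = 0. Earlier columns vanish in both rows k and l and stay as they are.\<close>
        let ?c = "Y k k / r" and ?s = "Y k l / r"
        show ?thesis
        proof (rule rotate[of k l ?c ?s])
          show "k < n" "l < n" "k \<noteq> l" using step by auto
          show "?c\<^sup>2 + ?s\<^sup>2 = 1"
            using r by (simp add: power_divide add_divide_distrib[symmetric] flip: r(1))
          show "?P (\<lambda>j. rot k l ?c ?s (Y j))"
            using step.prems step.hyps by (intro step.IH) (auto simp: rot_def less_Suc_eq)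
        qed
      qed
    qed
    from this[of "Suc k" Y] show ?case
      using step \<open>d < n\<close> by auto
  qed
  from this[of 0 Y] show ?thesis by simp
qed

section \<open>Sums of Gaussian squares\<close>

text \<open>Both measures agree on boxes by Fubini. This makes the Gaussian product measure a
  density on Lebesgue product space, where radial functions can be recognised.\<close>

lemma PiM_density:
  assumes "finite I" and f [measurable]: "f \<in> borel_measurable borel" and "prob_space (density lborel f)"
  shows "(\<Pi>\<^sub>M i\<in>I. density lborel f) = density (\<Pi>\<^sub>M i\<in>I. lborel) (\<lambda>x. \<Prod>i\<in>I. f (x i :: real))"
proof -
  interpret N: product_sigma_finite "\<lambda>_. density lborel f"
    using assms by (simp add: product_sigma_finite_def prob_space_imp_sigma_finite)
  interpret product_sigma_finite "\<lambda>_. lborel :: real measure"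
    by (simp add: product_sigma_finite_def sigma_finite_lborel)
  interpret finite_product_sigma_finite "\<lambda>_. lborel :: real measure" I
    by standard fact
  show ?thesis
  proof (rule N.PiM_eqI[symmetric])
    show "sets (density (\<Pi>\<^sub>M i\<in>I. lborel) (\<lambda>x. \<Prod>i\<in>I. f (x i))) = sets (\<Pi>\<^sub>M i\<in>I. density lborel f)"
      by (auto intro!: sets_PiM_cong)
    fix A assume A: "\<And>i. i \<in> I \<Longrightarrow> A i \<in> sets (density lborel f)"
    have [measurable]: "Pi\<^sub>E I A \<in> sets (\<Pi>\<^sub>M i\<in>I. lborel)"
      using A \<open>finite I\<close> by (intro sets_PiM_I_finite) auto
    have [measurable]: "(\<lambda>x. \<Prod>i\<in>I. f (x i)) \<in> borel_measurable (\<Pi>\<^sub>M i\<in>I. lborel)"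
      by measurable
    have "emeasure (density (\<Pi>\<^sub>M i\<in>I. lborel) (\<lambda>x. \<Prod>i\<in>I. f (x i))) (Pi\<^sub>E I A)
        = (\<integral>\<^sup>+x. (\<Prod>i\<in>I. f (x i) * indicator (A i) (x i)) \<partial>(\<Pi>\<^sub>M i\<in>I. lborel))"
      using \<open>finite I\<close>
      by (subst emeasure_density)
         (auto intro!: nn_integral_cong simp: prod.distrib indicator_def space_PiM PiE_iff split: if_splits)
    also have "\<dots> = (\<Prod>i\<in>I. \<integral>\<^sup>+x. f x * indicator (A i) x \<partial>lborel)"
      using A \<open>finite I\<close> by (intro product_nn_integral_prod) auto
    also have "\<dots> = (\<Prod>i\<in>I. emeasure (density lborel f) (A i))"
      using A by (intro prod.cong) (auto simp: emeasure_density)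
    finally show "emeasure (density (\<Pi>\<^sub>M i\<in>I. lborel) (\<lambda>x. \<Prod>i\<in>I. f (x i))) (Pi\<^sub>E I A)
        = (\<Prod>i\<in>I. emeasure (density lborel f) (A i))" .
  qed fact
qed

text \<open>The preimage of \<open>{..t}\<close> is the ball of radius sqrt (2 * t), whose volume is
  a multiple of t powr (card I / 2); the density is the derivative of that volume. The image measure
  is infinite, so uniqueness is applied on half-lines, all of finite mass.\<close>

lemma distr_lborel_half_sum_squares:
  assumes "finite I" "I \<noteq> {}"
  shows "distr (\<Pi>\<^sub>M i\<in>I. lborel) borel (\<lambda>x. (\<Sum>i\<in>I. (x i)\<^sup>2) / 2)
       = density lborel (\<lambda>t. ennreal ((2 * pi) powr (real (card I) / 2) / Gamma (real (card I) / 2)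
            * t powr (real (card I) / 2 - 1)) * indicator {0<..} t)"
    (is "?D = density lborel ?f")
proof (rule measure_eqI_generator_eq[where E = "range atMost" and \<Omega> = UNIV and A = "\<lambda>n. {..real n}"])
  define a where "a = real (card I) / 2"
  have a: "a > 0" using assms by (simp add: a_def card_gt_0_iff)
  let ?C = "(2 * pi) powr a / Gamma (a + 1)"
  have D: "emeasure ?D {..t} = ennreal (?C * (max 0 t) powr a)" for t
  proof -
    have pos: "emeasure ?D {..t} = ennreal (?C * t powr a)" if "t > 0" for t
    proof -
      have "(\<lambda>x. (\<Sum>i\<in>I. (x i)\<^sup>2) / 2) -` {..t} \<inter> space (\<Pi>\<^sub>M i\<in>I. lborel)
          = {f. sqrt (\<Sum>i\<in>I. (f i)\<^sup>2) \<le> sqrt (2 * t)} \<inter> space (\<Pi>\<^sub>M i\<in>I. lborel)"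
        by auto
      then have "emeasure ?D {..t} = ennreal (unit_ball_vol (real (card I)) * sqrt (2 * t) ^ card I)"
        using emeasure_cball_aux[OF \<open>finite I\<close>, of "sqrt (2 * t)"] that
        by (subst emeasure_distr) auto
      also have "sqrt (2 * t) ^ card I = (2 * t) powr a"
        using that by (simp add: a_def powr_half_sqrt[symmetric] powr_powr powr_realpow[symmetric])
      finally show ?thesis
        using that by (simp add: unit_ball_vol_def a_def powr_mult)
    qed
    consider "t < 0" | "t = 0" | "t > 0" by linarith
    then show ?thesis
    proof cases
      case 1
      have "\<not> (\<Sum>i\<in>I. (f i)\<^sup>2) / 2 \<le> t" for f :: "_ \<Rightarrow> real"
        using 1 sum_nonneg[of I "\<lambda>i. (f i)\<^sup>2"] by simp
      then have "(\<lambda>x. (\<Sum>i\<in>I. (x i)\<^sup>2) / 2) -` {..t} \<inter> space (\<Pi>\<^sub>M i\<in>I. lborel) = {}"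
        by blast
      then show ?thesis
        using 1 a by (subst emeasure_distr) auto
    next
      case 2
      \<comment> \<open>The mass of the closed half-line ending at 0 is squeezed by the volumes of
        shrinking balls.\<close>
      have "(\<lambda>k. ennreal (?C * (1 / real (Suc k)) powr a)) \<longlonglongrightarrow> ennreal (?C * 0 powr a)"
        using a by (intro tendsto_intros LIMSEQ_Suc lim_1_over_n tendsto_powr') auto
      moreover have "emeasure ?D {..0} \<le> ennreal (?C * (1 / real (Suc k)) powr a)" for k
        using emeasure_mono[of "{..0}" "{..1 / real (Suc k)}" ?D] pos[of "1 / real (Suc k)"] by simp
      ultimately have "emeasure ?D {..0} \<le> ennreal (?C * 0 powr a)"
        by (intro tendsto_lowerbound[of _ _ sequentially]) auto
      then show ?thesis using 2 a by simp
    qed (simp add: pos)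
  qed
  have F: "emeasure (density lborel ?f) {..t} = ennreal (?C * (max 0 t) powr a)" for t
  proof (cases "t > 0")
    case True
    let ?c = "(2 * pi) powr a / Gamma a"
    have "((\<lambda>x. ?c * x powr (a - 1)) has_integral ?c * (t powr a / a)) {0..t}"
      using has_integral_powr_from_0[of "a - 1" t] True a by (intro has_integral_mult_right) simp
    then have "(\<integral>\<^sup>+x. ennreal (?c * x powr (a - 1)) * indicator {0..t} x \<partial>lborel) = ennreal (?c * (t powr a / a))"
      using a by (intro nn_integral_has_integral_lebesgue') auto
    also have "?c * (t powr a / a) = ?C * t powr a"
      using a Gamma_plus1[of a] nonpos_Ints_nonpos[of a] by (fastforce simp: field_simps)
    also have "(\<integral>\<^sup>+x. ennreal (?c * x powr (a - 1)) * indicator {0..t} x \<partial>lborel)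
             = (\<integral>\<^sup>+x. ?f x * indicator {..t} x \<partial>lborel)"
      by (intro nn_integral_cong_AE AE_I[where N = "{0}"]) (auto simp: a_def indicator_def)
    finally show ?thesis
      using True by (subst emeasure_density) auto
  next
    case False
    then have "(\<integral>\<^sup>+x. ?f x * indicator {..t} x \<partial>lborel) = (\<integral>\<^sup>+x. 0 \<partial>(lborel :: real measure))"
      by (intro nn_integral_cong) (auto simp: indicator_def)
    then show ?thesis
      using False a by (subst emeasure_density) auto
  qed
  show "emeasure ?D X = emeasure (density lborel ?f) X" if "X \<in> range atMost" for X
    using that D F by auto
  show "emeasure ?D {..real i} \<noteq> \<infinity>" for i
    unfolding D by simp
  show "sets ?D = sigma_sets UNIV (range atMost)" "sets (density lborel ?f) = sigma_sets UNIV (range atMost)"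
    by (simp_all add: borel_eq_atMost)
  show "(\<Union>i. {..real i}) = UNIV"
    by (auto intro: real_arch_simple)
  show "Int_stable (range (atMost :: real \<Rightarrow> _))"
    by (auto simp: Int_stable_def)
qed auto

text \<open>Half the squared norm is Gamma distributed with shape card I / 2. The Gaussian density
  is a function of it, so it passes through the image measure, and the powers of 2 * pi
  cancel.\<close>

lemma distr_gauss_half_sum_squares:
  assumes "finite I" "I \<noteq> {}"
  shows "distr (gauss I) borel (\<lambda>x. (\<Sum>i\<in>I. (x i)\<^sup>2) / 2)
       = density lborel (\<lambda>t. ennreal (t powr (real (card I) / 2 - 1) * exp (- t) / Gamma (real (card I) / 2))
            * indicator {0<..} t)"
proof -
  define a where "a = real (card I) / 2"
  have a: "a > 0" using assms by (simp add: a_def card_gt_0_iff)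
  let ?T = "\<lambda>x::_ \<Rightarrow> real. (\<Sum>i\<in>I. (x i)\<^sup>2) / 2"
  let ?h = "\<lambda>t. ennreal ((2 * pi) powr (- a) * exp (- t))"
  have T [measurable]: "?T \<in> borel_measurable (\<Pi>\<^sub>M i\<in>I. lborel)"
    by measurable
  have "(\<Prod>i\<in>I. ennreal (std_normal_density (x i))) = ?h (?T x)" for x
  proof -
    have "(\<Prod>i\<in>I. std_normal_density (x i)) = (1 / sqrt (2 * pi)) ^ card I * exp (- ?T x)"
      using \<open>finite I\<close>
      by (simp add: std_normal_density_def prod_dividef prod_constant exp_sum[symmetric] power_divide
          sum_negf sum_divide_distrib)
    also have "(1 / sqrt (2 * pi)) ^ card I = (2 * pi) powr (- a)"
      by (simp add: a_def powr_half_sqrt[symmetric] powr_minus_divide[symmetric] powr_powr powr_realpow[symmetric])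
    finally show ?thesis
      by (simp add: prod_ennreal)
  qed
  then have "gauss I = density (\<Pi>\<^sub>M i\<in>I. lborel) (\<lambda>x. ?h (?T x))"
    by (subst PiM_density) (auto simp: assms prob_space_normal_density)
  then have "distr (gauss I) borel ?T = distr (density (\<Pi>\<^sub>M i\<in>I. lborel) (\<lambda>x. ?h (?T x))) borel ?T"
    by simp
  also have "\<dots> = density (distr (\<Pi>\<^sub>M i\<in>I. lborel) borel ?T) ?h"
    by (rule density_distr[symmetric]) auto
  also have "\<dots> = density lborel (\<lambda>t. ennreal ((2 * pi) powr a / Gamma a * t powr (a - 1)) * indicator {0<..} t * ?h t)"
    by (simp add: distr_lborel_half_sum_squares[OF assms] a_def density_density_eq)
  also have "\<dots> = density lborel (\<lambda>t. ennreal (t powr (a - 1) * exp (- t) / Gamma a) * indicator {0<..} t)"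
    using a by (intro density_cong) (auto simp: indicator_def ennreal_mult'[symmetric] powr_minus field_simps intro!: AE_I2)
  finally show ?thesis
    unfolding a_def .
qed

text \<open>Euler's integral is transferred from the gauge integral to a Lebesgue integral, for
  which series may be integrated term by term.\<close>

lemma integrable_Gamma_integrand:
  assumes "Re z > 0"
  shows "set_integrable lborel {0<..} (\<lambda>t. of_real t powr (z - 1) * of_real (exp (- t)))"
    and "(LINT t:{0<..}|lborel. of_real t powr (z - 1) * of_real (exp (- t))) = Gamma z"
proof -
  let ?f = "\<lambda>t. of_real t powr (z - 1) * of_real (exp (- t)) :: complex"
  have "?f absolutely_integrable_on {0<..}"
    using absolutely_integrable_Gamma_integral'[of z] assms
    by (simp add: exp_minus field_simps)
  then show int: "set_integrable lborel {0<..} ?f"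
    unfolding set_integrable_def
    by (subst (asm) integrable_completion)
       (auto intro!: borel_measurable_continuous_on_indicator continuous_intros simp: complex_nonpos_Reals_iff)
  have "((\<lambda>t. indicator {0<..} t *\<^sub>R ?f t) has_integral (LINT t:{0<..}|lborel. ?f t)) UNIV"
    using has_integral_integral_lborel[OF int[unfolded set_integrable_def]]
    by (simp add: set_lebesgue_integral_def)
  then have "(?f has_integral (LINT t:{0<..}|lborel. ?f t)) {0<..}"
    unfolding has_integral_restrict_UNIV[of "{0<..}", symmetric]
    by (rule has_integral_eq[rotated]) simp
  moreover have "(?f has_integral Gamma z) {0<..}"
    using Gamma_integral_complex'[OF assms] by (simp add: exp_minus field_simps)
  ultimately show "(LINT t:{0<..}|lborel. ?f t) = Gamma z"
    by (rule has_integral_unique)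
qed

text \<open>Expanding the oscillating factor reduces this to the binomial series, whence the restriction on
  \<open>u\<close>; it is harmless because the central limit theorem only needs \<open>u\<close> close to 0.\<close>

lemma Gamma_integral_complex_rate:
  assumes z: "Re z > 0" and u: "\<bar>u\<bar> < 1"
  shows "(LINT t:{0<..}|lborel. of_real t powr (z - 1) * of_real (exp (- t)) * exp (- \<i> * of_real (u * t)))
       = Gamma z * (1 + \<i> * of_real u) powr (- z)"
proof -
  \<comment> \<open>\<open>?f k\<close> is the k-th term of the exponential series of the
    oscillating factor; up to the constant \<open>?c k\<close> it is the Gamma integrand
    \<open>?w k\<close> with argument z + k.\<close>
  let ?f = "\<lambda>k t. indicator {0<..} t *\<^sub>R (of_real t powr (z - 1) * of_real (exp (- t)) * ((- \<i> * of_real (u * t)) ^ k / fact k)) :: complex"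
  let ?w = "\<lambda>k t. indicator {0<..} t *\<^sub>R (of_real t powr (z + of_nat k - 1) * of_real (exp (- t))) :: complex"
  let ?c = "\<lambda>k. (- \<i> * of_real u) ^ k / fact k"
  have fw: "?f k = (\<lambda>t. ?c k * ?w k t)" for k
  proof
    fix t :: real
    have "of_real t powr (z + of_nat k - 1) = of_real t powr (z - 1) * (of_real t :: complex) ^ k" if "t > 0"
      using that powr_add[of "of_real t :: complex" "z - 1" "of_nat k"]
      by (simp add: algebra_simps powr_nat')
    then show "?f k t = ?c k * ?w k t"
      by (cases "t > 0") (simp_all add: power_mult_distrib[symmetric] algebra_simps)
  qed
  have zk: "Re (z + of_nat k) > 0" for k using z by simp
  have int_w: "integrable lborel (?w k)" and val_w: "(\<integral>t. ?w k t \<partial>lborel) = Gamma (z + of_nat k)" for k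
    using integrable_Gamma_integrand[OF zk[of k]]
    by (simp_all add: set_integrable_def set_lebesgue_integral_def)
  have int_f: "integrable lborel (?f k)" for k
    unfolding fw using int_w by (intro integrable_mult_right) auto
  have val_f: "(\<integral>t. ?f k t \<partial>lborel) = ?c k * Gamma (z + of_nat k)" for k
    unfolding fw by (simp only: integral_mult_right_zero val_w)
  have norm_f: "(\<integral>t. norm (?f k t) \<partial>lborel) = \<bar>u\<bar> ^ k / fact k * Gamma (Re z + real k)" for k
  proof -
    have Rz: "Re (of_real (Re z) + of_nat k :: complex) > 0" using z by simp
    have "(LINT t:{0<..}|lborel. of_real t powr (of_real (Re z) + of_nat k - 1) * complex_of_real (exp (- t)))
        = (LINT t:{0<..}|lborel. complex_of_real (t powr (Re z + real k - 1) * exp (- t)))"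
      by (intro set_lebesgue_integral_cong) (auto simp: powr_of_real[symmetric])
    then have "complex_of_real (LINT t:{0<..}|lborel. t powr (Re z + real k - 1) * exp (- t)) = of_real (Gamma (Re z + real k))"
      using integrable_Gamma_integrand(2)[OF Rz]
      by (simp add: set_integral_complex_of_real Gamma_complex_of_real[symmetric] del: of_real_mult)
    then have *: "(LINT t:{0<..}|lborel. t powr (Re z + real k - 1) * exp (- t)) = Gamma (Re z + real k)"
      by (simp only: of_real_eq_iff)
    have "(\<integral>t. norm (?f k t) \<partial>lborel)
        = (\<integral>t. \<bar>u\<bar> ^ k / fact k * (indicator {0<..} t *\<^sub>R (t powr (Re z + real k - 1) * exp (- t))) \<partial>lborel)"
    proof (intro Bochner_Integration.integral_cong refl)
      fix t :: real
      show "norm (?f k t) = \<bar>u\<bar> ^ k / fact k * (indicator {0<..} t *\<^sub>R (t powr (Re z + real k - 1) * exp (- t)))"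
        unfolding fw
        using powr_add[of t "Re z - 1" "real k"]
        by (cases "t > 0") (simp_all add: norm_mult norm_divide norm_power norm_powr_real_powr powr_realpow algebra_simps)
    qed
    also have "\<dots> = \<bar>u\<bar> ^ k / fact k * Gamma (Re z + real k)"
      using * by (simp add: set_lebesgue_integral_def)
    finally show ?thesis .
  qed
  have poch: "?c k * Gamma (z + of_nat k) = Gamma z * (((- z) gchoose k) * (\<i> * of_real u) ^ k)" for k
  proof -
    have "z \<notin> \<int>\<^sub>\<le>\<^sub>0" using z by (auto elim!: nonpos_Ints_cases')
    then have "Gamma (z + of_nat k) = pochhammer z k * Gamma z"
      by (simp add: pochhammer_Gamma Gamma_eq_zero_iff)
    moreover have "(- \<i> * complex_of_real u) ^ k = (- 1) ^ k * (\<i> * of_real u) ^ k"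
      by (simp add: power_mult_distrib[symmetric])
    ultimately show ?thesis
      by (simp add: gbinomial_pochhammer)
  qed
  have sumf: "(\<lambda>k. ?f k t) sums (indicator {0<..} t *\<^sub>R (of_real t powr (z - 1) * of_real (exp (- t)) * exp (- \<i> * of_real (u * t))))" for t
    using exp_converges[of "- \<i> * of_real (u * t) :: complex"]
    by (intro sums_scaleR_right sums_mult) (simp add: scaleR_conv_of_real field_simps)
  have summ_norm: "summable (\<lambda>k. norm (?f k t))" for t
  proof -
    have "norm (?f k t) = norm (indicator {0<..} t *\<^sub>R (of_real t powr (z - 1) * of_real (exp (- t)) :: complex))
        * (norm (- \<i> * of_real (u * t) :: complex) ^ k /\<^sub>R fact k)" for k
      by (simp only: norm_mult norm_divide norm_power norm_scaleR norm_fact divide_inverse scaleR_conv_of_real mult_ac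
        norm_inverse of_real_eq_id id_apply)
    then show ?thesis
      by (simp only:) (intro summable_mult summable_exp_generic)
  qed
  \<comment> \<open>The integrals of the norms add up to Gamma (Re z) times the absolute binomial
    series of exponent -Re z at radius \<open>\<bar>u\<bar>\<close>, which converges because
    \<open>\<bar>u\<bar> < 1\<close>. This justifies exchanging sum and integral.\<close>
  have summ_int: "summable (\<lambda>k. \<integral>t. norm (?f k t) \<partial>lborel)"
  proof -
    let ?a = "Re z"
    have "summable (\<lambda>k. norm (((- ?a) gchoose k) * \<bar>u\<bar> ^ k))"
      using u by (intro abs_summable_in_conv_radius) (simp add: conv_radius_gchoose one_ereal_def)
    then have "summable (\<lambda>k. Gamma ?a * norm (((- ?a) gchoose k) * \<bar>u\<bar> ^ k))"
      by (rule summable_mult)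
    moreover have "Gamma ?a * norm (((- ?a) gchoose k) * \<bar>u\<bar> ^ k) = \<bar>u\<bar> ^ k / fact k * Gamma (?a + real k)" for k
    proof -
      have "?a \<notin> \<int>\<^sub>\<le>\<^sub>0" using z by (auto elim!: nonpos_Ints_cases')
      then have "Gamma (?a + of_nat k) = pochhammer ?a k * Gamma ?a"
        by (simp add: pochhammer_Gamma Gamma_eq_zero_iff)
      moreover have "norm ((- ?a) gchoose k) = pochhammer ?a k / fact k"
        using pochhammer_pos[OF z, of k] by (simp add: gbinomial_pochhammer abs_mult)
      ultimately show ?thesis
        by (simp add: abs_mult)
    qed
    ultimately show ?thesis
      by (simp only: norm_f)
  qed
  have "(\<lambda>k. \<integral>t. ?f k t \<partial>lborel) sums (\<integral>t. (\<Sum>k. ?f k t) \<partial>lborel)"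
    by (rule sums_integral) (use int_f summ_norm summ_int in auto)
  moreover have "(\<lambda>k. \<integral>t. ?f k t \<partial>lborel) sums (Gamma z * (1 + \<i> * of_real u) powr (- z))"
    unfolding val_f poch
    using u by (intro sums_mult gen_binomial_complex) (simp add: norm_mult)
  ultimately have "(\<integral>t. (\<Sum>k. ?f k t) \<partial>lborel) = Gamma z * (1 + \<i> * of_real u) powr (- z)"
    by (rule sums_unique2)
  moreover have "(\<integral>t. (\<Sum>k. ?f k t) \<partial>lborel)
      = (LINT t:{0<..}|lborel. of_real t powr (z - 1) * of_real (exp (- t)) * exp (- \<i> * of_real (u * t)))"
    unfolding set_lebesgue_integral_def
    by (intro Bochner_Integration.integral_cong refl sums_unique[OF sumf, symmetric])
  ultimately show ?thesis by simp
qed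

section \<open>Expectations of functions of a Gaussian squared norm\<close>

lemma integral_gauss_half_sum_squares:
  fixes g :: "real \<Rightarrow> complex"
  assumes "finite I" "I \<noteq> {}" and [measurable]: "g \<in> borel_measurable borel"
  defines "a \<equiv> real (card I) / 2"
  shows "(\<integral>x. g ((\<Sum>i\<in>I. (x i)\<^sup>2) / 2) \<partial>gauss I)
       = (LINT t:{0<..}|lborel. of_real (t powr (a - 1) * exp (- t) / Gamma a) * g t)"
proof -
  have a: "a > 0" using assms by (simp add: a_def card_gt_0_iff)
  have "(\<lambda>x. (\<Sum>i\<in>I. (x i)\<^sup>2) / 2) \<in> borel_measurable (gauss I)"
    by (intro borel_measurable_divide borel_measurable_sum borel_measurable_power)
       (simp_all add: measurable_gauss_component)
  then have "(\<integral>x. g ((\<Sum>i\<in>I. (x i)\<^sup>2) / 2) \<partial>gauss I)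
      = (\<integral>t. g t \<partial>distr (gauss I) borel (\<lambda>x. (\<Sum>i\<in>I. (x i)\<^sup>2) / 2))"
    by (simp add: integral_distr)
  also have "\<dots> = (\<integral>t. g t \<partial>density lborel (\<lambda>t. ennreal (indicator {0<..} t * (t powr (a - 1) * exp (- t) / Gamma a))))"
    unfolding distr_gauss_half_sum_squares[OF assms(1,2)] a_def[symmetric]
    by (intro arg_cong[of _ _ "\<lambda>M. integral\<^sup>L M g"] density_cong AE_I2) (auto simp: indicator_def)
  also have "\<dots> = (LINT t:{0<..}|lborel. of_real (t powr (a - 1) * exp (- t) / Gamma a) * g t)"
    using a by (subst integral_density)
       (auto simp: set_lebesgue_integral_def scaleR_conv_of_real indicator_def intro!: AE_I2 Bochner_Integration.integral_cong)
  finally show ?thesis .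
qed

text \<open>The power \<open>x\<close> to the \<open>\<i> v\<close>, set to 0 for \<open>x \<le> 0\<close>: it is multiplicative
  without exceptional null sets, and for \<open>v = 0\<close> it is the indicator of \<open>x > 0\<close>.\<close>

definition unit_powr :: "real \<Rightarrow> real \<Rightarrow> complex" where
  "unit_powr v x = (if 0 < x then exp (\<i> * of_real (v * ln x)) else 0)"

lemma measurable_unit_powr [measurable]: "unit_powr v \<in> borel_measurable borel"
  unfolding unit_powr_def by measurable

lemma norm_unit_powr_le: "norm (unit_powr v x) \<le> 1"
  by (simp add: unit_powr_def)

text \<open>Only one factor carries a sign condition. In the induction over columns that factor is a
  sum of squares, so the argument never asks for the sign of a Gram determinant.\<close>

lemma unit_powr_mult: "0 \<le> y \<Longrightarrow> unit_powr v (x * y) = unit_powr v x * unit_powr v y"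
  by (auto simp: unit_powr_def ln_mult zero_less_mult_iff exp_add[symmetric] algebra_simps)

text \<open>The expected contribution of a column of length n whose projection off d fixed
  directions is measured. The power of 1 + iu involves n / 2 and not (n - d) / 2, because the full
  norm of the column enters with u while only n - d squares enter with v.\<close>

definition chisq_factor :: "nat \<Rightarrow> nat \<Rightarrow> real \<Rightarrow> real \<Rightarrow> complex" where
  "chisq_factor n d v u = unit_powr v 2 * Gamma (of_real (real (n - d) / 2) + \<i> * of_real v)
      / Gamma (of_real (real (n - d) / 2)) * (1 + \<i> * of_real u) powr (- (of_nat n / 2 + \<i> * of_real v))"

lemma integral_gauss_exp_sum_squares:
  assumes "finite I" "I \<noteq> {}" "\<bar>u\<bar> < 1"
  shows "(\<integral>x. exp (- \<i> * of_real (u * ((\<Sum>i\<in>I. (x i)\<^sup>2) / 2))) \<partial>gauss I)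
       = (1 + \<i> * of_real u) powr (- of_nat (card I) / 2)"
proof -
  let ?a = "real (card I) / 2"
  have a: "?a > 0" using assms by (simp add: card_gt_0_iff)
  have "(\<integral>x. exp (- \<i> * of_real (u * ((\<Sum>i\<in>I. (x i)\<^sup>2) / 2))) \<partial>gauss I)
      = (LINT t:{0<..}|lborel. of_real (t powr (?a - 1) * exp (- t) / Gamma ?a) * exp (- \<i> * of_real (u * t)))"
    using assms by (intro integral_gauss_half_sum_squares) auto
  also have "\<dots> = (LINT t:{0<..}|lborel. 1 / of_real (Gamma ?a) * (of_real t powr (of_real ?a - 1) * of_real (exp (- t)) * exp (- \<i> * of_real (u * t))))"
    by (intro set_lebesgue_integral_cong) (auto simp: powr_of_real[symmetric])
  also have "\<dots> = 1 / of_real (Gamma ?a) * (Gamma (of_real ?a) * (1 + \<i> * of_real u) powr (- of_real ?a))"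
    using Gamma_integral_complex_rate[of "of_real ?a" u] a assms by (subst set_integral_mult_right) simp
  also have "\<dots> = (1 + \<i> * of_real u) powr (- of_nat (card I) / 2)"
    using Gamma_real_pos[OF a] Gamma_complex_of_real[of ?a] by (simp add: less_imp_neq[symmetric])
  finally show ?thesis .
qed

text \<open>An imaginary power of a Gamma variable shifts its shape from a to a + iv inside the
  Gamma integral. The factor \<open>unit_powr v 2\<close> undoes the halving of the sum of
  squares.\<close>

lemma integral_gauss_unit_powr_sum_squares:
  assumes "finite I" "I \<noteq> {}" "\<bar>u\<bar> < 1"
  defines "a \<equiv> complex_of_real (real (card I) / 2)"
  shows "(\<integral>x. unit_powr v (\<Sum>i\<in>I. (x i)\<^sup>2) * exp (- \<i> * of_real (u * ((\<Sum>i\<in>I. (x i)\<^sup>2) / 2))) \<partial>gauss I)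
       = unit_powr v 2 * Gamma (a + \<i> * of_real v) / Gamma a * (1 + \<i> * of_real u) powr (- (a + \<i> * of_real v))"
proof -
  let ?a = "real (card I) / 2" and ?z = "a + \<i> * of_real v"
  have a: "?a > 0" using assms by (simp add: card_gt_0_iff)
  let ?g = "\<lambda>t. unit_powr v (2 * t) * exp (- \<i> * of_real (u * t))"
  have "(\<integral>x. unit_powr v (\<Sum>i\<in>I. (x i)\<^sup>2) * exp (- \<i> * of_real (u * ((\<Sum>i\<in>I. (x i)\<^sup>2) / 2))) \<partial>gauss I)
      = (\<integral>x. ?g ((\<Sum>i\<in>I. (x i)\<^sup>2) / 2) \<partial>gauss I)"
    by simp
  also have "\<dots> = (LINT t:{0<..}|lborel. of_real (t powr (?a - 1) * exp (- t) / Gamma ?a) * ?g t)"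
    by (intro integral_gauss_half_sum_squares assms) measurable
  also have "\<dots> = (LINT t:{0<..}|lborel. unit_powr v 2 / Gamma a * (of_real t powr (?z - 1) * of_real (exp (- t)) * exp (- \<i> * of_real (u * t))))"
  proof (intro set_lebesgue_integral_cong allI impI)
    fix t :: real assume "t \<in> {0<..}"
    then have t: "t > 0" by simp
    have "of_real t powr (?z - 1) = of_real (t powr (?a - 1)) * unit_powr v t"
      using t powr_add[of "complex_of_real t" "of_real (?a - 1)" "\<i> * of_real v"]
      by (simp add: a_def powr_of_real[symmetric] unit_powr_def powr_def[of _ "\<i> * of_real v"] Ln_of_real algebra_simps)
    then show "of_real (t powr (?a - 1) * exp (- t) / Gamma ?a) * ?g t
        = unit_powr v 2 / Gamma a * (of_real t powr (?z - 1) * of_real (exp (- t)) * exp (- \<i> * of_real (u * t)))"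
      using t Gamma_complex_of_real[of ?a] by (simp add: unit_powr_mult a_def)
  qed simp
  also have "\<dots> = unit_powr v 2 / Gamma a * (Gamma ?z * (1 + \<i> * of_real u) powr (- ?z))"
    using Gamma_integral_complex_rate[of ?z u] a assms by (subst set_integral_mult_right) (simp add: a_def)
  finally show ?thesis by simp
qed

text \<open>The first d coordinates and the remaining n - d are independent. The first block
  contributes a power of 1 + iu only, and the exponents of the two blocks add up.\<close>

lemma integral_gauss_column:
  assumes "0 < d" "d < n" "\<bar>u\<bar> < 1"
  shows "(\<integral>x. unit_powr v (\<Sum>i\<in>{d..<n}. (x i)\<^sup>2) * exp (- \<i> * of_real (u * ((\<Sum>i<n. (x i)\<^sup>2) / 2))) \<partial>gauss {..<n})
       = chisq_factor n d v u"
proof -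
  interpret product_sigma_finite "\<lambda>_. std_normal_distribution"
    by (simp add: product_sigma_finite_def prob_space_normal_density prob_space_imp_sigma_finite)
  have n: "{..<n} = {..<d} \<union> {d..<n}" using assms by auto
  have comp: "(\<lambda>x. \<Sum>i\<in>J. (x i)\<^sup>2) \<in> borel_measurable (gauss I)" if "J \<subseteq> I" for I J :: "nat set"
    using that by (intro borel_measurable_sum borel_measurable_power) (auto simp: measurable_gauss_component)
  let ?e = "\<lambda>s. exp (- \<i> * complex_of_real (u * (s / 2)))"
  let ?F = "\<lambda>x. unit_powr v (\<Sum>i\<in>{d..<n}. (x i)\<^sup>2) * ?e (\<Sum>i<n. (x i)\<^sup>2)"
  have split: "(\<Sum>i<n. g i) = (\<Sum>i<d. g i) + (\<Sum>i\<in>{d..<n}. g i)" for g :: "nat \<Rightarrow> real"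
    unfolding n by (rule sum.union_disjoint) auto
  have "?F \<in> borel_measurable (gauss {..<n})"
  proof -
    have "(\<lambda>x. unit_powr v (\<Sum>i\<in>{d..<n}. (x i)\<^sup>2)) \<in> borel_measurable (gauss {..<n})"
      using comp[of "{d..<n}" "{..<n}"] by (rule measurable_compose) (auto simp: measurable_unit_powr)
    moreover have "(\<lambda>x. ?e (\<Sum>i<n. (x i)\<^sup>2)) \<in> borel_measurable (gauss {..<n})"
      using comp[of "{..<n}" "{..<n}"] by (rule measurable_compose) auto
    ultimately show ?thesis by (rule borel_measurable_times)
  qed
  moreover have "norm (?F x) \<le> 1" for x
    using norm_unit_powr_le[of v] by (simp add: norm_mult)
  ultimately have int: "integrable (gauss {..<n}) ?F"
    using prob_space_gauss[of "{..<n}"]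
    by (intro finite_measure.integrable_const_bound[where B = 1]) (auto simp: prob_space_def)
  have "(\<integral>x. ?F x \<partial>gauss {..<n})
      = (\<integral>x. (\<integral>y. ?F (merge {..<d} {d..<n} (x, y)) \<partial>gauss {d..<n}) \<partial>gauss {..<d})"
    using int unfolding n by (intro product_integral_fold) auto
  also have "\<dots> = (\<integral>x. (\<integral>y. ?e (\<Sum>i<d. (x i)\<^sup>2) * (unit_powr v (\<Sum>i\<in>{d..<n}. (y i)\<^sup>2) * ?e (\<Sum>i\<in>{d..<n}. (y i)\<^sup>2)) \<partial>gauss {d..<n}) \<partial>gauss {..<d})"
  proof (intro Bochner_Integration.integral_cong refl)
    fix x y :: "nat \<Rightarrow> real"
    have "(\<Sum>i\<in>{d..<n}. (merge {..<d} {d..<n} (x, y) i)\<^sup>2) = (\<Sum>i\<in>{d..<n}. (y i)\<^sup>2)"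
      "(\<Sum>i<d. (merge {..<d} {d..<n} (x, y) i)\<^sup>2) = (\<Sum>i<d. (x i)\<^sup>2)"
      by (auto intro!: sum.cong simp: merge_def)
    then show "?F (merge {..<d} {d..<n} (x, y))
        = ?e (\<Sum>i<d. (x i)\<^sup>2) * (unit_powr v (\<Sum>i\<in>{d..<n}. (y i)\<^sup>2) * ?e (\<Sum>i\<in>{d..<n}. (y i)\<^sup>2))"
      by (simp add: split exp_add[symmetric] algebra_simps add_divide_distrib)
  qed
  also have "\<dots> = (\<integral>x. ?e (\<Sum>i<d. (x i)\<^sup>2) \<partial>gauss {..<d})
      * (\<integral>y. unit_powr v (\<Sum>i\<in>{d..<n}. (y i)\<^sup>2) * ?e (\<Sum>i\<in>{d..<n}. (y i)\<^sup>2) \<partial>gauss {d..<n})"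
    by (simp only: integral_mult_right_zero integral_mult_left_zero)
  also have "\<dots> = (1 + \<i> * of_real u) powr (- of_nat d / 2) * (unit_powr v 2 * Gamma (of_real (real (n - d) / 2) + \<i> * of_real v)
      / Gamma (of_real (real (n - d) / 2)) * (1 + \<i> * of_real u) powr (- (of_real (real (n - d) / 2) + \<i> * of_real v)))"
    using assms by (subst integral_gauss_exp_sum_squares, (auto)[3], subst integral_gauss_unit_powr_sum_squares) auto
  also have "\<dots> = chisq_factor n d v u"
  proof -
    have "(1 + \<i> * of_real u) powr (- of_nat d / 2) * (1 + \<i> * of_real u) powr (- (of_real (real (n - d) / 2) + \<i> * of_real v))
        = (1 + \<i> * of_real u) powr (- of_nat d / 2 + (- (of_real (real (n - d) / 2) + \<i> * of_real v)))"
      by (rule powr_add[symmetric])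
    also have "- of_nat d / 2 + (- (of_real (real (n - d) / 2) + \<i> * of_real v)) = - (of_nat n / 2 + \<i> * complex_of_real v)"
      using assms by (simp add: of_nat_diff field_simps)
    finally show ?thesis
      by (simp add: chisq_factor_def mult_ac)
  qed
  finally show ?thesis .
qed

section \<open>The scatter determinant\<close>

text \<open>With the constant vector as column 0, centring the data becomes projection off that
  column, so the scatter determinant needs no separate treatment of the mean.\<close>

definition augment :: "(nat \<times> nat \<Rightarrow> real) \<Rightarrow> nat \<Rightarrow> nat \<Rightarrow> real" where
  "augment x k i = (if k = 0 then 1 else x (i, k - 1))"

lemma measurable_augmented_gram_det:
  assumes "{..<n} \<times> {..<p} \<subseteq> I"
  shows "(\<lambda>x. gram_det n (Suc p) (augment x)) \<in> borel_measurable (gauss I)"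
proof (rule measurable_gram_det)
  fix j i assume "j < Suc p" "i < n"
  then show "(\<lambda>x. augment x j i) \<in> borel_measurable (gauss I)"
    using assms by (cases "j = 0") (auto simp: augment_def intro!: measurable_gauss_component)
qed

text \<open>Induction on p, integrating out the newest data column with the older ones fixed. The
  constant column counts as a direction, so the first data column already has d = 1; for p = 0 the
  Gram determinant is the squared length n of that column.\<close>

lemma integral_gauss_gram_det:
  assumes "p < n" "\<bar>u\<bar> < 1"
  shows "(\<integral>x. unit_powr v (gram_det n (Suc p) (augment x))
            * exp (- \<i> * of_real (u * ((\<Sum>k\<in>{..<n} \<times> {..<p}. (x k)\<^sup>2) / 2))) \<partial>gauss ({..<n} \<times> {..<p}))
       = unit_powr v (real n) * (\<Prod>d\<in>{1..p}. chisq_factor n d v u)"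
  using \<open>p < n\<close>
proof (induction p)
  case 0
  interpret prob_space "gauss ({} :: (nat \<times> nat) set)" by (rule prob_space_gauss)
  have "gram_det n (Suc 0) (augment x) = real n" for x
  proof -
    have "gram_det n (Suc 0) (augment x) = det (mat 1 1 (\<lambda>_. real n))"
      unfolding gram_det_def by (intro arg_cong[of _ _ det] eq_matI) (auto simp: augment_def)
    then show ?thesis by (simp add: det_single)
  qed
  then show ?case by (simp add: prob_space)
next
  case (Suc p)
  interpret product_sigma_finite "\<lambda>_. std_normal_distribution"
    by (simp add: product_sigma_finite_def prob_space_normal_density prob_space_imp_sigma_finite)
  let ?e = "\<lambda>s. exp (- \<i> * complex_of_real (u * (s / 2)))"
  let ?A = "{..<n} \<times> {..<p}" and ?B = "{..<n} \<times> {p}"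
  let ?F = "\<lambda>x. unit_powr v (gram_det n (Suc (Suc p)) (augment x)) * ?e (\<Sum>k\<in>?A \<union> ?B. (x k)\<^sup>2)"
  let ?H = "\<lambda>x y. unit_powr v (gram_det n (Suc (Suc p)) (\<lambda>j. if j = Suc p then y else augment x j)) * ?e (\<Sum>i<n. (y i)\<^sup>2)"
  have AB: "{..<n} \<times> {..<Suc p} = ?A \<union> ?B" by auto
  have F: "?F \<in> borel_measurable (gauss (?A \<union> ?B))"
  proof -
    have "(\<lambda>x. unit_powr v (gram_det n (Suc (Suc p)) (augment x))) \<in> borel_measurable (gauss (?A \<union> ?B))"
      by (rule measurable_compose[OF measurable_augmented_gram_det measurable_unit_powr]) auto
    moreover have "(\<lambda>x. \<Sum>k\<in>?A \<union> ?B. (x k)\<^sup>2) \<in> borel_measurable (gauss (?A \<union> ?B))"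
      by (intro borel_measurable_sum borel_measurable_power measurable_gauss_component)
    then have "(\<lambda>x. ?e (\<Sum>k\<in>?A \<union> ?B. (x k)\<^sup>2)) \<in> borel_measurable (gauss (?A \<union> ?B))"
      by (rule measurable_compose) auto
    ultimately show ?thesis by (rule borel_measurable_times)
  qed
  have "norm (?F x) \<le> 1" for x
    using norm_unit_powr_le[of v] by (simp add: norm_mult)
  with F have int: "integrable (gauss (?A \<union> ?B)) ?F"
    using prob_space_gauss[of "?A \<union> ?B"]
    by (intro finite_measure.integrable_const_bound[where B = 1]) (auto simp: prob_space_def)
  have H: "?H x \<in> borel_measurable (gauss {..<n})" for x
  proof -
    have "(\<lambda>y. gram_det n (Suc (Suc p)) (\<lambda>j. if j = Suc p then y else augment x j)) \<in> borel_measurable (gauss {..<n})"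
    proof (rule measurable_gram_det)
      fix j i assume "i < n"
      then show "(\<lambda>y. (if j = Suc p then y else augment x j) i) \<in> borel_measurable (gauss {..<n})"
        by (cases "j = Suc p") (auto simp: measurable_gauss_component)
    qed
    then have "(\<lambda>y. unit_powr v (gram_det n (Suc (Suc p)) (\<lambda>j. if j = Suc p then y else augment x j))) \<in> borel_measurable (gauss {..<n})"
      by (rule measurable_compose[OF _ measurable_unit_powr])
    moreover have "(\<lambda>y. \<Sum>i<n. (y i)\<^sup>2) \<in> borel_measurable (gauss {..<n})"
      by (intro borel_measurable_sum borel_measurable_power measurable_gauss_component)
    then have "(\<lambda>y. ?e (\<Sum>i<n. (y i)\<^sup>2)) \<in> borel_measurable (gauss {..<n})"
      by (rule measurable_compose) auto
    ultimately show ?thesis by (rule borel_measurable_times)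
  qed
  \<comment> \<open>\<open>?t\<close> reads the new column, indexed by pairs, as a vector indexed by
    \<open>{..<n}\<close>, and preserves the Gaussian law.\<close>
  let ?t = "\<lambda>y. \<lambda>i\<in>{..<n}. y (i, p)"
  have t: "?t \<in> measurable (gauss ?B) (gauss {..<n})"
    by (rule measurable_restrict) (auto intro!: measurable_component_singleton)
  have reindex: "distr (gauss ?B) (gauss {..<n}) ?t = gauss {..<n}"
    by (rule distr_PiM_reindex) (auto simp: prob_space_normal_density inj_on_def)
  have "(\<integral>x. ?F x \<partial>gauss (?A \<union> ?B)) = (\<integral>x. (\<integral>y. ?F (merge ?A ?B (x, y)) \<partial>gauss ?B) \<partial>gauss ?A)"
    using int by (intro product_integral_fold) auto
  also have "\<dots> = (\<integral>x. (\<integral>y. ?e (\<Sum>k\<in>?A. (x k)\<^sup>2) * ?H x (?t y) \<partial>gauss ?B) \<partial>gauss ?A)"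
  proof (intro Bochner_Integration.integral_cong refl)
    fix x y :: "nat \<times> nat \<Rightarrow> real"
    let ?z = "merge ?A ?B (x, y)"
    have "gram_det n (Suc (Suc p)) (augment ?z) = gram_det n (Suc (Suc p)) (\<lambda>j. if j = Suc p then ?t y else augment x j)"
    proof (intro gram_det_cong sum.cong refl)
      have *: "augment ?z j i = (if j = Suc p then ?t y else augment x j) i" if "j < Suc (Suc p)" "i < n" for j i
        using that by (auto simp: augment_def merge_def)
      show "augment ?z j i * augment ?z k i
          = (if j = Suc p then ?t y else augment x j) i * (if k = Suc p then ?t y else augment x k) i"
        if "j < Suc (Suc p)" "k < Suc (Suc p)" "i \<in> {..<n}" for i j k
        using that *[of j i] *[of k i] by simp
    qed
    moreover have "(\<Sum>k\<in>?A \<union> ?B. (?z k)\<^sup>2) = (\<Sum>k\<in>?A. (x k)\<^sup>2) + (\<Sum>i<n. (?t y i)\<^sup>2)"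
    proof -
      have "(\<Sum>k\<in>?A \<union> ?B. (?z k)\<^sup>2) = (\<Sum>k\<in>?A. (?z k)\<^sup>2) + (\<Sum>k\<in>?B. (?z k)\<^sup>2)"
        by (rule sum.union_disjoint) auto
      also have "(\<Sum>k\<in>?A. (?z k)\<^sup>2) = (\<Sum>k\<in>?A. (x k)\<^sup>2)"
        by (intro sum.cong) (auto simp: merge_def)
      also have "(\<Sum>k\<in>?B. (?z k)\<^sup>2) = (\<Sum>i<n. (?t y i)\<^sup>2)"
        by (rule sum.reindex_bij_witness[of _ "\<lambda>i. (i, p)" fst]) (auto simp: merge_def)
      finally show ?thesis .
    qed
    ultimately show "?F ?z = ?e (\<Sum>k\<in>?A. (x k)\<^sup>2) * ?H x (?t y)"
      by (simp only:) (simp add: exp_add[symmetric] algebra_simps add_divide_distrib)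
  qed
  also have "\<dots> = (\<integral>x. ?e (\<Sum>k\<in>?A. (x k)\<^sup>2) * (\<integral>y. ?H x y \<partial>gauss {..<n}) \<partial>gauss ?A)"
  proof (intro Bochner_Integration.integral_cong refl)
    fix x :: "nat \<times> nat \<Rightarrow> real"
    have "(\<integral>y. ?H x (?t y) \<partial>gauss ?B) = (\<integral>y. ?H x y \<partial>distr (gauss ?B) (gauss {..<n}) ?t)"
      using t H by (rule integral_distr[symmetric])
    then show "(\<integral>y. ?e (\<Sum>k\<in>?A. (x k)\<^sup>2) * ?H x (?t y) \<partial>gauss ?B)
        = ?e (\<Sum>k\<in>?A. (x k)\<^sup>2) * (\<integral>y. ?H x y \<partial>gauss {..<n})"
      by (simp only: integral_mult_right_zero reindex)
  qed
  also have "\<dots> = (\<integral>x. (unit_powr v (gram_det n (Suc p) (augment x)) * ?e (\<Sum>k\<in>?A. (x k)\<^sup>2)) * chisq_factor n (Suc p) v u \<partial>gauss ?A)"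
  proof (intro Bochner_Integration.integral_cong refl)
    fix x :: "nat \<times> nat \<Rightarrow> real"
    have "(\<integral>y. ?H x y \<partial>gauss {..<n})
        = (\<integral>y. unit_powr v (gram_det n (Suc p) (augment x) * (\<Sum>i\<in>{Suc p..<n}. (y i)\<^sup>2)) * ?e (\<Sum>i<n. (y i)\<^sup>2) \<partial>gauss {..<n})"
      by (rule integral_gram_det_add_column[where f = "\<lambda>D s. unit_powr v D * ?e s"])
         (use Suc.prems in simp_all)
    also have "\<dots> = (\<integral>y. unit_powr v (gram_det n (Suc p) (augment x)) * (unit_powr v (\<Sum>i\<in>{Suc p..<n}. (y i)\<^sup>2) * ?e (\<Sum>i<n. (y i)\<^sup>2)) \<partial>gauss {..<n})"
      by (simp only: unit_powr_mult[OF sum_nonneg[OF zero_le_power2]] mult.assoc)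
    also have "\<dots> = unit_powr v (gram_det n (Suc p) (augment x)) * chisq_factor n (Suc p) v u"
      using integral_gauss_column[of "Suc p" n u v] Suc.prems assms by (simp only: integral_mult_right_zero)
    finally show "?e (\<Sum>k\<in>?A. (x k)\<^sup>2) * (\<integral>y. ?H x y \<partial>gauss {..<n})
        = (unit_powr v (gram_det n (Suc p) (augment x)) * ?e (\<Sum>k\<in>?A. (x k)\<^sup>2)) * chisq_factor n (Suc p) v u"
      by (simp only: mult_ac)
  qed
  also have "\<dots> = unit_powr v (real n) * (\<Prod>d\<in>{1..p}. chisq_factor n d v u) * chisq_factor n (Suc p) v u"
    using Suc by (simp only: integral_mult_left_zero Suc_lessD)
  finally show ?case
    by (simp add: AB mult_ac)
qed

text \<open>Subtracting its mean times the constant column from each data column is the unimodular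
  column operation U. Centred columns are orthogonal to the constant one, so the new Gram matrix is
  block diagonal with blocks n and the scatter matrix.\<close>

lemma gram_det_augment:
  assumes "n > 0"
  shows "gram_det n (Suc p) (augment x) = real n * det (scatter_mat n p (\<lambda>i j. x (i, j)))"
proof -
  let ?m = "sample_mean n (\<lambda>i j. x (i, j))"
  define Y where "Y = mat n (Suc p) (\<lambda>(i, j). augment x j i)"
  define U where "U = mat (Suc p) (Suc p) (\<lambda>(k, j). if k = j then 1 else if k = 0 then - ?m (j - 1) else 0)"
  define Z where "Z = mat n (Suc p) (\<lambda>(i, j). if j = 0 then 1 else x (i, j - 1) - ?m (j - 1))"
  have carrier: "Y \<in> carrier_mat n (Suc p)" "U \<in> carrier_mat (Suc p) (Suc p)" "Z \<in> carrier_mat n (Suc p)"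
    by (simp_all add: Y_def U_def Z_def)
  have "Y * U = Z"
  proof (rule eq_matI)
    fix i j assume "i < dim_row Z" "j < dim_col Z"
    then have ij: "i < n" "j < Suc p" by (simp_all add: Z_def)
    have "(Y * U) $$ (i, j) = (\<Sum>k<Suc p. augment x k i * (if k = j then 1 else if k = 0 then - ?m (j - 1) else 0))"
      using ij by (simp add: Y_def U_def scalar_prod_def atLeast0LessThan)
    also have "\<dots> = (\<Sum>k<Suc p. (if k = j then augment x k i else 0) + (if k = 0 then if j = 0 then 0 else - ?m (j - 1) else 0))"
      by (intro sum.cong refl) (auto simp: augment_def)
    also have "\<dots> = Z $$ (i, j)"
      using ij by (simp add: sum.distrib Z_def augment_def del: sum.lessThan_Suc)
    finally show "(Y * U) $$ (i, j) = Z $$ (i, j)" .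
  qed (simp_all add: Y_def U_def Z_def)
  have "upper_triangular U" by (auto simp: U_def)
  then have "det U = prod_list (diag_mat U)"
    using carrier(2) by (rule det_upper_triangular)
  also have "diag_mat U = map (\<lambda>_. 1) [0..<Suc p]"
    unfolding diag_mat_def by (intro map_cong) (auto simp: U_def)
  finally have "det U = 1"
    by (simp add: map_replicate_const del: upt_Suc)
  have gram: "gram_det n (Suc p) (augment x) = det (transpose_mat Y * Y)"
    unfolding gram_det_def
    by (intro arg_cong[of _ _ det] eq_matI) (auto simp: Y_def scalar_prod_def atLeast0LessThan)
  have "transpose_mat Z * Z = transpose_mat U * (transpose_mat Y * Y) * U"
    unfolding \<open>Y * U = Z\<close>[symmetric] using carrier
    by (simp add: transpose_mult[of _ n "Suc p" _ "Suc p"] assoc_mult_mat[of _ "Suc p" n _ "Suc p" _ "Suc p"]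
        assoc_mult_mat[of _ "Suc p" "Suc p" _ n _ "Suc p"] assoc_mult_mat[of _ "Suc p" "Suc p" _ "Suc p" _ "Suc p"])
  then have "gram_det n (Suc p) (augment x) = det (transpose_mat Z * Z)"
    using carrier \<open>det U = 1\<close> gram by (simp add: det_mult[of _ "Suc p"] det_transpose[of U "Suc p"])
  also have "transpose_mat Z * Z = four_block_mat (mat 1 1 (\<lambda>_. real n)) (0\<^sub>m 1 p) (0\<^sub>m p 1) (scatter_mat n p (\<lambda>i j. x (i, j)))"
  proof (rule eq_matI)
    have centred: "(\<Sum>i<n. x (i, j) - ?m j) = 0" for j
      using assms by (simp add: sum_subtractf sample_mean_def)
    fix j k assume "j < dim_row (four_block_mat (mat 1 1 (\<lambda>_. real n)) (0\<^sub>m 1 p) (0\<^sub>m p 1) (scatter_mat n p (\<lambda>i j. x (i, j))))"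
      "k < dim_col (four_block_mat (mat 1 1 (\<lambda>_. real n)) (0\<^sub>m 1 p) (0\<^sub>m p 1) (scatter_mat n p (\<lambda>i j. x (i, j))))"
    then have jk: "j < Suc p" "k < Suc p" by (simp_all add: scatter_mat_def)
    then show "(transpose_mat Z * Z) $$ (j, k)
        = four_block_mat (mat 1 1 (\<lambda>_. real n)) (0\<^sub>m 1 p) (0\<^sub>m p 1) (scatter_mat n p (\<lambda>i j. x (i, j))) $$ (j, k)"
      using centred
      by (cases j; cases k) (auto simp: Z_def scatter_mat_def scalar_prod_def atLeast0LessThan)
  qed (simp_all add: Z_def scatter_mat_def)
  also have "det \<dots> = det (mat 1 1 (\<lambda>_. real n)) * det (scatter_mat n p (\<lambda>i j. x (i, j)))"
    by (rule det_four_block_mat_upper_right_zero) (auto simp: scatter_mat_def)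
  finally show ?thesis by (simp add: det_single)
qed

section \<open>Polygamma estimates\<close>

text \<open>In each case the difference of the two sides vanishes at 0 and has a nonnegative
  derivative. The cubic remainder is chosen because the logarithm will be multiplied by a factor of
  order 1 / w, and an error of order w^2 can still be telescoped.\<close>

lemma ln_one_minus_bounds:
  fixes w :: real
  assumes "0 \<le> w"
  shows "w < 1 \<Longrightarrow> w + w\<^sup>2 / 2 \<le> - ln (1 - w)"
    and "w \<le> 1 / 2 \<Longrightarrow> - ln (1 - w) \<le> w + w\<^sup>2 / 2 + w ^ 3"
proof -
  assume "w < 1"
  let ?f = "\<lambda>w. - ln (1 - w) - w - w\<^sup>2 / 2 :: real"
  have "?f 0 \<le> ?f w"
  proof (rule DERIV_nonneg_imp_nondecreasing[OF assms])
    fix x assume "0 \<le> x" "x \<le> w"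
    then show "\<exists>D. DERIV ?f x :> D \<and> 0 \<le> D"
      using \<open>w < 1\<close> by (intro exI[of _ "1 / (1 - x) - 1 - x"]) (auto intro!: derivative_eq_intros simp: field_simps)
  qed
  then show "w + w\<^sup>2 / 2 \<le> - ln (1 - w)" by simp
next
  assume "w \<le> 1 / 2"
  let ?f = "\<lambda>w. w + w\<^sup>2 / 2 + w ^ 3 + ln (1 - w) :: real"
  have "?f 0 \<le> ?f w"
  proof (rule DERIV_nonneg_imp_nondecreasing[OF assms])
    fix x assume x: "0 \<le> x" "x \<le> w"
    have "1 / (1 - x) = 1 + x + x\<^sup>2 / (1 - x)"
      using x \<open>w \<le> 1 / 2\<close> by (simp add: field_simps power2_eq_square)
    moreover have "x\<^sup>2 / (1 - x) \<le> 2 * x\<^sup>2"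
      using x \<open>w \<le> 1 / 2\<close> divide_left_mono[of "1 / 2" "1 - x" "x\<^sup>2"] by simp
    ultimately have "0 \<le> 1 + x + 3 * x\<^sup>2 - 1 / (1 - x)"
      using zero_le_power2[of x] by linarith
    then show "\<exists>D. DERIV ?f x :> D \<and> 0 \<le> D"
      using x \<open>w \<le> 1 / 2\<close> by (intro exI[of _ "1 + x + 3 * x\<^sup>2 - 1 / (1 - x)"]) (auto intro!: derivative_eq_intros simp: field_simps)
  qed
  then show "- ln (1 - w) \<le> w + w\<^sup>2 / 2 + w ^ 3" by simp
qed

lemma ln_one_plus_bounds:
  fixes w :: real
  assumes "0 \<le> w"
  shows "w - w\<^sup>2 / 2 \<le> ln (1 + w)" and "ln (1 + w) \<le> w - w\<^sup>2 / 2 + w ^ 3 / 3"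
proof -
  let ?f = "\<lambda>w. ln (1 + w) - w + w\<^sup>2 / 2 :: real"
  have "?f 0 \<le> ?f w"
  proof (rule DERIV_nonneg_imp_nondecreasing[OF assms])
    fix x assume "0 \<le> x" "x \<le> w"
    then show "\<exists>D. DERIV ?f x :> D \<and> 0 \<le> D"
      by (intro exI[of _ "1 / (1 + x) - 1 + x"]) (auto intro!: derivative_eq_intros simp: field_simps)
  qed
  then show "w - w\<^sup>2 / 2 \<le> ln (1 + w)" by simp
  let ?g = "\<lambda>w. w - w\<^sup>2 / 2 + w ^ 3 / 3 - ln (1 + w) :: real"
  have "?g 0 \<le> ?g w"
  proof (rule DERIV_nonneg_imp_nondecreasing[OF assms])
    fix x assume x: "0 \<le> x" "x \<le> w"
    then have "0 \<le> 1 - x + x\<^sup>2 - 1 / (1 + x)"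
      by (simp add: field_simps power2_eq_square)
    then show "\<exists>D. DERIV ?g x :> D \<and> 0 \<le> D"
      using x by (intro exI[of _ "1 - x + x\<^sup>2 - 1 / (1 + x)"]) (auto intro!: derivative_eq_intros simp: field_simps)
  qed
  then show "ln (1 + w) \<le> w - w\<^sup>2 / 2 + w ^ 3 / 3" by simp
qed

text \<open>The right side is (2 * y + 1) / (y^2 * (y + 1)^2), and y + 1 is at most 2 * y. Sums of
  inverse cubes are thereby bounded by telescoping sums.\<close>

lemma inverse_cube_le_diff_inverse_square:
  fixes y :: real
  assumes "1 \<le> y"
  shows "1 / (2 * y ^ 3) \<le> 1 / y\<^sup>2 - 1 / (y + 1)\<^sup>2"
proof -
  have "(y + 1)\<^sup>2 \<le> (2 * y)\<^sup>2"
    using assms by (intro power_mono) auto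
  then have "(y + 1)\<^sup>2 \<le> 2 * y * (2 * y + 1)"
    using assms by (simp add: power2_eq_square algebra_simps)
  then have "1 / (2 * y ^ 3) \<le> (2 * y + 1) / (y\<^sup>2 * (y + 1)\<^sup>2)"
    using assms by (simp add: divide_simps) (simp add: power2_eq_square power3_eq_cube algebra_simps)
  also have "\<dots> = 1 / y\<^sup>2 - 1 / (y + 1)\<^sup>2"
    using assms by (simp add: divide_simps) (simp add: power2_eq_square algebra_simps)
  finally show ?thesis .
qed

text \<open>The approximation g satisfies the recurrence of Digamma, increment 1 / y over a unit
  step, up to an error dominated by an increment of -1 / y^2. Summing along x, x + 1, ... and
  comparing with the limit formula for Digamma leaves at most 1 / x^2.\<close>

lemma Digamma_approx:
  fixes x :: real
  assumes "1 \<le> x"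
  shows "\<bar>Digamma x - (ln x - 1 / (2 * x))\<bar> \<le> 1 / x\<^sup>2"
proof -
  define g where "g y = ln y - 1 / (2 * y)" for y :: real
  define b where "b y = 1 / y\<^sup>2" for y :: real
  have r: "\<bar>g (y + 1) - g y - 1 / y\<bar> \<le> b y - b (y + 1)" if "1 \<le> y" for y
  proof -
    define w where "w = 1 / y"
    have w: "0 < w" "y = 1 / w" using that by (simp_all add: w_def)
    have "y + 1 = y * (1 + w)" using that by (simp add: w_def field_simps)
    then have "ln (y + 1) = ln y + ln (1 + w)"
      using that w ln_mult[of y "1 + w"] by simp
    then have "g (y + 1) - g y - 1 / y = ln (1 + w) - (1 / y + 1 / (y + 1)) / 2"
      by (simp add: g_def add_divide_distrib diff_divide_distrib algebra_simps)
    \<comment> \<open>The defect compares ln (1 + w), the integral of the reciprocal over a unit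
      interval, with its trapezoidal value; the two agree up to third order in w.\<close>
    also have "(1 / y + 1 / (y + 1)) / 2 = w - w\<^sup>2 / (2 * (1 + w))"
      using w(1) unfolding w(2) by (simp add: divide_simps) (simp add: power2_eq_square algebra_simps)
    finally have eq: "g (y + 1) - g y - 1 / y = ln (1 + w) - (w - w\<^sup>2 / (2 * (1 + w)))" .
    have "w\<^sup>2 / (2 * (1 + w)) \<le> w\<^sup>2 / 2"
      using w(1) by (intro divide_left_mono) auto
    moreover have "w\<^sup>2 / 2 - w\<^sup>2 / (2 * (1 + w)) \<le> w ^ 3 / 2"
    proof -
      have "w\<^sup>2 / 2 - w\<^sup>2 / (2 * (1 + w)) = w ^ 3 / (2 * (1 + w))"
        using w(1) by (simp add: divide_simps) (simp add: power2_eq_square power3_eq_cube algebra_simps)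
      also have "\<dots> \<le> w ^ 3 / 2"
        using w(1) by (intro divide_left_mono) auto
      finally show ?thesis .
    qed
    moreover have "w ^ 3 / 3 \<le> w ^ 3 / 2" using w(1) by simp
    ultimately have "\<bar>ln (1 + w) - (w - w\<^sup>2 / (2 * (1 + w)))\<bar> \<le> w ^ 3 / 2"
      using ln_one_plus_bounds[of w] w(1) unfolding abs_le_iff by linarith
    also have "\<dots> = 1 / (2 * y ^ 3)" by (simp add: w_def power_one_over)
    also have "\<dots> \<le> b y - b (y + 1)"
      using inverse_cube_le_diff_inverse_square[OF that] by (simp add: b_def)
    finally show ?thesis by (simp add: eq)
  qed
  let ?s = "\<lambda>M. \<Sum>k<M. g (x + real k + 1) - g (x + real k) - 1 / (x + real k)"
  have bound: "\<bar>?s M\<bar> \<le> 1 / x\<^sup>2" for M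
  proof -
    have "\<bar>g (x + real k + 1) - g (x + real k) - 1 / (x + real k)\<bar> \<le> b (x + real k) - b (x + real (Suc k))" for k
    proof -
      have "x + real (Suc k) = x + real k + 1" by simp
      then show ?thesis using r[of "x + real k"] assms by (simp only:)
    qed
    then have "\<bar>?s M\<bar> \<le> (\<Sum>k<M. b (x + real k) - b (x + real (Suc k)))"
      by (intro order.trans[OF sum_abs] sum_mono)
    also have "\<dots> = b x - b (x + real M)"
      by (subst sum_lessThan_telescope') simp
    also have "\<dots> \<le> 1 / x\<^sup>2" by (simp add: b_def)
    finally show ?thesis .
  qed
  have s: "?s M = g (x + real M) - g x - (\<Sum>k<M. inverse (x + real k))" for M
  proof -
    have "(\<Sum>k<M. g (x + real (Suc k)) - g (x + real k)) = g (x + real M) - g x"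
      by (subst sum_lessThan_telescope) simp
    then show ?thesis
      by (simp add: sum_subtractf inverse_eq_divide add_ac)
  qed
  have "(\<lambda>M. ln (real M) - (\<Sum>k<M. inverse (x + real k)) - (ln (real M) - g (x + real M)) - g x) \<longlonglongrightarrow> Digamma x - 0 - g x"
  proof (intro tendsto_diff tendsto_const)
    show "(\<lambda>M. ln (real M) - (\<Sum>k<M. inverse (x + real k))) \<longlonglongrightarrow> Digamma x"
      using Digamma_LIMSEQ[of x] assms by simp
    show "(\<lambda>M. ln (real M) - g (x + real M)) \<longlonglongrightarrow> 0"
      unfolding g_def using assms by real_asymp
  qed
  then have "(\<lambda>M. g (x + real M) - g x - (\<Sum>k<M. inverse (x + real k))) \<longlonglongrightarrow> Digamma x - g x"
    by (simp add: algebra_simps)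
  then have "?s \<longlonglongrightarrow> Digamma x - g x"
    unfolding s .
  then have "(\<lambda>M. \<bar>?s M\<bar>) \<longlonglongrightarrow> \<bar>Digamma x - g x\<bar>"
    by (rule tendsto_rabs)
  then have "\<bar>Digamma x - g x\<bar> \<le> 1 / x\<^sup>2"
    by (rule tendsto_upperbound) (use bound in auto)
  then show ?thesis by (simp add: g_def)
qed

text \<open>Each term 1 / y^2 of the series lies between the decrease of 1 / y and that of 1 / y + 1
  / y^2 over a unit step.\<close>

lemma Trigamma_bounds:
  fixes x :: real
  assumes "0 < x"
  shows "1 / x \<le> Polygamma 1 x" "Polygamma 1 x \<le> 1 / x + 1 / x\<^sup>2"
proof -
  have eq: "Polygamma 1 x = (\<Sum>k. inverse ((x + real k)\<^sup>2))"
    by (simp add: Polygamma_def numeral_2_eq_2)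
  have summ: "summable (\<lambda>k. inverse ((x + real k)\<^sup>2))"
    using assms by (intro Polygamma_converges') auto
  have tele: "(\<lambda>k. f (x + real k) - f (x + real (Suc k))) sums f x"
    if "((\<lambda>k. f (x + real k)) \<longlonglongrightarrow> 0)" for f :: "real \<Rightarrow> real"
    using telescope_sums'[OF that] by simp
  have 1: "(\<lambda>k. 1 / (x + real k) - 1 / (x + real (Suc k))) sums (1 / x)"
    by (rule tele) real_asymp
  have 2: "(\<lambda>k. (1 / (x + real k) + 1 / (x + real k)\<^sup>2) - (1 / (x + real (Suc k)) + 1 / (x + real (Suc k))\<^sup>2)) sums (1 / x + 1 / x\<^sup>2)"
    by (rule tele) real_asymp
  have *: "1 / y - 1 / (y + 1) \<le> 1 / y\<^sup>2" "1 / (y + 1)\<^sup>2 \<le> 1 / y - 1 / (y + 1)" if "0 < y" for y :: real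
  proof -
    have "1 / y - 1 / (y + 1) = 1 / (y * (y + 1))"
      using that by (simp add: field_simps)
    moreover have "1 / (y * (y + 1)) \<le> 1 / y\<^sup>2" "1 / (y + 1)\<^sup>2 \<le> 1 / (y * (y + 1))"
      using that by (auto simp: power2_eq_square intro!: divide_left_mono)
    ultimately show "1 / y - 1 / (y + 1) \<le> 1 / y\<^sup>2" "1 / (y + 1)\<^sup>2 \<le> 1 / y - 1 / (y + 1)"
      by simp_all
  qed
  show "1 / x \<le> Polygamma 1 x"
    unfolding eq sums_unique[OF 1]
    by (intro suminf_le sums_summable[OF 1] summ)
       (use assms *(1)[of "x + real k" for k] in \<open>simp add: inverse_eq_divide add_ac\<close>)
  show "Polygamma 1 x \<le> 1 / x + 1 / x\<^sup>2"
    unfolding eq sums_unique[OF 2]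
  proof (intro suminf_le sums_summable[OF 2] summ)
    fix k show "inverse ((x + real k)\<^sup>2) \<le> (1 / (x + real k) + 1 / (x + real k)\<^sup>2) - (1 / (x + real (Suc k)) + 1 / (x + real (Suc k))\<^sup>2)"
      using assms *(2)[of "x + real k"] by (simp add: inverse_eq_divide add_ac)
  qed
qed

text \<open>Since |z + k| is at least Re z + k, the series is dominated by its value at the real
  part. The bound is thus uniform along vertical lines, as the Taylor remainder requires.\<close>

lemma norm_Tetragamma_le:
  fixes z :: complex
  assumes "1 \<le> Re z"
  shows "norm (Polygamma 2 z) \<le> 4 / (Re z)\<^sup>2"
proof -
  let ?x = "Re z"
  have "z \<noteq> 0" using assms by auto
  have tele: "(\<lambda>k. 2 / (?x + real k)\<^sup>2 - 2 / (?x + real (Suc k))\<^sup>2) sums (2 / ?x\<^sup>2)"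
  proof -
    have "(\<lambda>k. 2 / (?x + real k)\<^sup>2) \<longlonglongrightarrow> 0" by real_asymp
    from telescope_sums'[OF this] show ?thesis by simp
  qed
  have le: "norm (inverse ((z + of_nat k) ^ 3)) \<le> 2 / (?x + real k)\<^sup>2 - 2 / (?x + real (Suc k))\<^sup>2" for k
  proof -
    have "?x + real k \<le> norm (z + of_nat k)"
      using complex_Re_le_cmod[of "z + of_nat k"] by simp
    then have "norm (inverse ((z + of_nat k) ^ 3)) \<le> 1 / (?x + real k) ^ 3"
      using assms unfolding norm_inverse norm_power inverse_eq_divide[symmetric]
      by (intro le_imp_inverse_le power_mono zero_less_power) auto
    also have "\<dots> = 2 * (1 / (2 * (?x + real k) ^ 3))" by simp
    also have "\<dots> \<le> 2 * (1 / (?x + real k)\<^sup>2 - 1 / (?x + real k + 1)\<^sup>2)"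
      using assms by (intro mult_left_mono inverse_cube_le_diff_inverse_square) auto
    finally show ?thesis by (simp add: add_ac)
  qed
  have summ: "summable (\<lambda>k. norm (inverse ((z + of_nat k) ^ 3)))"
    by (rule summable_comparison_test'[OF sums_summable[OF tele], of 0]) (use le in auto)
  have "norm (Polygamma 2 z) = 2 * norm (\<Sum>k. inverse ((z + of_nat k) ^ 3))"
    by (simp add: Polygamma_def norm_mult numeral_3_eq_3 numeral_2_eq_2)
  also have "norm (\<Sum>k. inverse ((z + of_nat k) ^ 3)) \<le> (\<Sum>k. norm (inverse ((z + of_nat k) ^ 3)))"
    by (rule summable_norm[OF summ])
  also have "\<dots> \<le> 2 / ?x\<^sup>2"
    unfolding sums_unique[OF tele] by (intro suminf_le summ sums_summable[OF tele] le)
  finally show ?thesis by simp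
qed

section \<open>Expansion of the logarithmic characteristic function\<close>

lemma sum_telescope_below:
  fixes f :: "nat \<Rightarrow> real"
  assumes "p < n"
  shows "(\<Sum>d\<in>{1..p}. f (n - d) - f (n - d - 1)) = f (n - 1) - f (n - 1 - p)"
  using assms
proof (induction p)
  case (Suc p)
  then show ?case by (simp add: atLeastAtMostSuc_conv)
qed simp

lemma inverse_square_le_diff_inverse:
  fixes x :: real
  assumes "2 \<le> x"
  shows "1 / x\<^sup>2 \<le> 1 / (x - 1) - 1 / x"
proof -
  have "1 / x\<^sup>2 \<le> 1 / ((x - 1) * x)"
    using assms by (intro divide_left_mono) (auto simp: power2_eq_square intro!: mult_right_mono)
  also have "\<dots> = 1 / (x - 1) - 1 / x"
    using assms by (subst diff_frac_eq) auto
  finally show ?thesis .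
qed

text \<open>Differences of this function approximate \<open>Digamma (m / 2)\<close> up to a telescoping error; its values at
  \<open>n - 1\<close> and \<open>n - 1 - p\<close> produce the logarithmic term of \<^const>\<open>mu_LR\<close>.\<close>

definition digamma_primitive :: "real \<Rightarrow> real" where
  "digamma_primitive x = (x - 1 / 2) * ln x - x - x * ln 2"

text \<open>With w = 1 / m, both quantities equal ln (m / 2) - w up to order w^2: Digamma with error
  4 * w^2, the difference of primitives with error w^2. This gives the constant 5.\<close>

lemma Digamma_half_approx:
  fixes m :: nat
  assumes "2 \<le> m"
  shows "\<bar>Digamma (real m / 2) - (digamma_primitive (real m) - digamma_primitive (real (m - 1)))\<bar>
     \<le> 5 * (1 / real (m - 1) - 1 / real m)"
proof -
  define x where "x = real m"
  define w where "w = 1 / x"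
  have x: "2 \<le> x" "real (m - 1) = x - 1" using assms by (auto simp: x_def of_nat_diff)
  have w: "0 < w" "w \<le> 1 / 2" "x = 1 / w" using x by (auto simp: w_def field_simps)
  let ?L = "- ln (1 - w)"
  have "ln (x - 1) = ln x + ln (1 - w)"
  proof -
    have "x * (1 - w) = x - 1" using x(1) by (simp add: w_def right_diff_distrib)
    then show ?thesis using x(1) w(2) ln_mult[of x "1 - w"] by simp
  qed
  then have D: "digamma_primitive x - digamma_primitive (x - 1) = ln (x / 2) - 1 + (x - 3 / 2) * ?L"
    using x by (simp add: digamma_primitive_def ln_div algebra_simps)
  have "\<bar>(x - 3 / 2) * ?L - 1 + w\<bar> \<le> w\<^sup>2"
  proof -
    have pos: "0 \<le> x - 3 / 2" using x by simp
    have xw: "x * w = 1" using x by (simp add: w_def)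
    have xw2: "x * w\<^sup>2 = w" "x * w ^ 3 = w\<^sup>2"
      using xw by (simp_all add: power2_eq_square power3_eq_cube mult.assoc[symmetric])
    have expand: "(x - 3 / 2) * (a + b / 2 + c) = x * a + x * b / 2 + x * c - 3 / 2 * a - 3 / 4 * b - 3 / 2 * c" for a b c :: real
      by (simp add: field_simps)
    have "(x - 3 / 2) * (w + w\<^sup>2 / 2) \<le> (x - 3 / 2) * ?L"
      using ln_one_minus_bounds(1)[of w] w pos by (intro mult_left_mono) auto
    moreover have "(x - 3 / 2) * ?L \<le> (x - 3 / 2) * (w + w\<^sup>2 / 2 + w ^ 3)"
      using ln_one_minus_bounds(2)[of w] w pos by (intro mult_left_mono) auto
    moreover have "(x - 3 / 2) * (w + w\<^sup>2 / 2) = 1 - w - 3 / 4 * w\<^sup>2"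
      using expand[of w "w\<^sup>2" 0] unfolding xw xw2 by simp
    moreover have "(x - 3 / 2) * (w + w\<^sup>2 / 2 + w ^ 3) = 1 - w - 3 / 4 * w\<^sup>2 + w\<^sup>2 - 3 / 2 * w ^ 3"
      using expand[of w "w\<^sup>2" "w ^ 3"] unfolding xw xw2 by simp
    moreover have "0 \<le> w\<^sup>2" "0 \<le> w ^ 3" using w by simp_all
    ultimately show ?thesis unfolding abs_le_iff by linarith
  qed
  moreover have "\<bar>Digamma (x / 2) - (ln (x / 2) - w)\<bar> \<le> 4 * w\<^sup>2"
    using Digamma_approx[of "x / 2"] x by (simp add: w_def power_divide)
  moreover have "w\<^sup>2 \<le> 1 / (x - 1) - 1 / x"
    using inverse_square_le_diff_inverse[OF x(1)] by (simp add: w_def power_one_over)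
  ultimately have "\<bar>Digamma (x / 2) - (digamma_primitive x - digamma_primitive (x - 1))\<bar> \<le> 5 * (1 / (x - 1) - 1 / x)"
    unfolding D by (auto simp: abs_le_iff)
  then show ?thesis using x by (simp add: x_def)
qed

text \<open>Below, \<open>\<i> * drift n p\<close> and \<open>- variance_sum n p\<close> are the first two derivatives at 0 of the logarithm of
  the characteristic function of \<open>ln \<Lambda>\<^sub>n - \<mu>\<^sub>n\<close>, and \<open>third_bound n p\<close> bounds its third derivative on the real line.\<close>

definition drift :: "nat \<Rightarrow> nat \<Rightarrow> real" where
  "drift n p = real n * real p / 2 * (1 - ln (real n / 2)) - mu_LR n p
     + real n / 2 * (\<Sum>d\<in>{1..p}. Digamma (real (n - d) / 2)) - real p * real n / 2"

definition variance_sum :: "nat \<Rightarrow> nat \<Rightarrow> real" where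
  "variance_sum n p = (real n)\<^sup>2 / 4 * (\<Sum>d\<in>{1..p}. Polygamma 1 (real (n - d) / 2)) - real p * real n / 2"

definition third_bound :: "nat \<Rightarrow> nat \<Rightarrow> real" where
  "third_bound n p = (real n / 2) ^ 3 * (\<Sum>d\<in>{1..p}. 4 / (real (n - d) / 2)\<^sup>2) + real p * real n / 2"

section \<open>Error bounds for drift, variance and third derivative at fixed n and p\<close>

context
  fixes n p :: nat
  assumes np: "p + 1 < n"
begin

lemma codim_pos: "0 < real (n - 1 - p)" and codim_eq: "real (n - 1 - p) = real n - 1 - real p" and two_le_n: "2 \<le> n"
  using np by auto

lemma one_minus_ratio_eq: "1 - real p / (real n - 1) = real (n - 1 - p) / real (n - 1)"
proof -
  have "1 - b / a = (a - b) / a" if "0 < a" for a b :: real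
    using that by (simp add: diff_divide_distrib)
  then show ?thesis using np by (simp add: of_nat_diff)
qed

lemma sum_inverse_le:
  "(\<Sum>d\<in>{1..p}. 1 / real (n - d - 1) - 1 / real (n - d)) \<le> 1 / real (n - 1 - p)"
proof -
  have "(\<Sum>d\<in>{1..p}. 1 / real (n - d - 1) - 1 / real (n - d)) = 1 / real (n - 1 - p) - 1 / real (n - 1)"
    using sum_telescope_below[of p n "\<lambda>m. - 1 / real m"] np by simp
  then show ?thesis by simp
qed

text \<open>The Digamma sum telescopes to a difference of \<open>digamma_primitive\<close> with
  error 5 / q, where q = n - 1 - p. Everything else cancels against \<open>mu_LR\<close> except
  \<open>?r\<close>, which costs at most 1 / q; multiplying by n / 2 gives 3 * n / q.\<close>

lemma abs_drift_le: "\<bar>drift n p\<bar> \<le> 3 * real n / real (n - 1 - p)"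
proof -
  let ?q = "real (n - 1 - p)" and ?N = "real (n - 1)" and ?G = "\<lambda>m. digamma_primitive (real m)"
  let ?S = "\<Sum>d\<in>{1..p}. Digamma (real (n - d) / 2)"
  have N: "?N = real n - 1" "?N > 0" "?N = ?q + real p" using np by (auto simp: of_nat_diff)
  have "\<bar>?S - (?G (n - 1) - ?G (n - 1 - p))\<bar>
      = \<bar>\<Sum>d\<in>{1..p}. Digamma (real (n - d) / 2) - (?G (n - d) - ?G (n - d - 1))\<bar>"
    using sum_telescope_below[of p n ?G] np by (simp add: sum_subtractf)
  also have "\<dots> \<le> (\<Sum>d\<in>{1..p}. 5 * (1 / real (n - d - 1) - 1 / real (n - d)))"
    using np by (intro order.trans[OF sum_abs] sum_mono Digamma_half_approx) auto
  also have "\<dots> \<le> 5 / ?q"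
    unfolding sum_distrib_left[symmetric] using sum_inverse_le by simp
  finally have 1: "\<bar>?S - (?G (n - 1) - ?G (n - 1 - p))\<bar> \<le> 5 / ?q" .
  \<comment> \<open>What remains from having ln n in the statistic but ln (n - 1) in the centring: p
    times the second-order remainder of ln (1 - 1 / n).\<close>
  let ?r = "real p * (ln ?N - ln (real n) + 1 / real n)"
  have 2: "\<bar>?r\<bar> \<le> 1 / ?q"
  proof -
    let ?w = "1 / real n"
    have w: "0 \<le> ?w" "?w \<le> 1 / 2" using two_le_n by (auto simp: field_simps)
    have "real n * (1 - ?w) = ?N"
      using two_le_n N(1) by (simp add: right_diff_distrib)
    then have "ln ?N = ln (real n) + ln (1 - ?w)"
      using two_le_n w ln_mult[of "real n" "1 - ?w"] by simp
    then have r: "?r = - (real p * (- ln (1 - ?w) - ?w))" by (simp add: algebra_simps)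
    have "0 \<le> - ln (1 - ?w) - ?w" using ln_one_minus_bounds(1)[of ?w] w zero_le_power2[of ?w] by linarith
    moreover have "- ln (1 - ?w) - ?w \<le> ?w\<^sup>2"
    proof -
      have "?w ^ 3 \<le> 1 / 2 * ?w\<^sup>2"
        using w mult_right_mono[of ?w "1 / 2" "?w\<^sup>2"] by (simp add: power3_eq_cube power2_eq_square)
      then show ?thesis using ln_one_minus_bounds(2)[of ?w] w by simp
    qed
    ultimately have "\<bar>?r\<bar> \<le> real p * ?w\<^sup>2"
      unfolding r abs_minus by (auto simp: abs_mult intro!: mult_left_mono)
    also have "\<dots> \<le> real n * ?w\<^sup>2" using np by (intro mult_right_mono) auto
    also have "\<dots> = 1 / real n" using two_le_n by (simp add: power2_eq_square)
    also have "\<dots> \<le> 1 / ?q" using np by (intro divide_left_mono) auto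
    finally show ?thesis .
  qed
  have mu: "mu_LR n p = real n / 2 * (- (?q - 1 / 2) * (ln ?q - ln ?N)) - (real n + 1) * real p / 2"
  proof -
    have coeff: "2 * real n - 2 * real p - 3 = 2 * ?q - 1" unfolding codim_eq by simp
    have ln_ratio: "ln (?q / ?N) = ln ?q - ln ?N" using N(2) codim_pos by (simp add: ln_div)
    have ring: "- 1 / 4 * (a * (2 * b - 1) * c + 2 * (a + 1) * d) = a / 2 * (- (b - 1 / 2) * c) - (a + 1) * d / 2" for a b c d :: real
      by (simp add: field_simps)
    show ?thesis unfolding mu_LR_def one_minus_ratio_eq coeff ln_ratio ring ..
  qed
  have ln2: "ln (real n / 2) = ln (real n) - ln 2" using two_le_n by (simp add: ln_div)
  have "drift n p = real n / 2 * (?S - real p * ln (real n / 2) + (?q - 1 / 2) * (ln ?q - ln ?N)) + (real n + 1) * real p / 2"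
  proof -
    have ring: "a * b / 2 * (1 - c) - (a / 2 * (- e * f) - (a + 1) * b / 2) + a / 2 * g - b * a / 2
        = a / 2 * (g - b * c + e * f) + (a + 1) * b / 2" for a b c e f g :: real
      by (simp add: algebra_simps add_divide_distrib diff_divide_distrib)
    show ?thesis unfolding drift_def mu ring ..
  qed
  also have "\<dots> = real n / 2 * ((?S - (?G (n - 1) - ?G (n - 1 - p))) + ?r)"
  proof -
    \<comment> \<open>The cancellation, with all logarithms treated as independent variables. The
      summand (a + 1) * b / 2 splits into a * b / 2, which comes from the linear part of the
      primitive, and b / 2, which is the 1 / a inside the last bracket.\<close>
    have ring: "a / 2 * (s - b * (la - l2) + (q - 1 / 2) * (lq - lN)) + (a + 1) * b / 2
        = a / 2 * ((s - (((q + b - 1 / 2) * lN - (q + b) - (q + b) * l2) - ((q - 1 / 2) * lq - q - q * l2)))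
            + b * (lN - la + 1 / a))" if "a \<noteq> 0" for a b la l2 q lq lN s :: real
    proof -
      have shift: "s - b * (la - l2) + (q - h) * (lq - lN) + b
          = (s - (((q + b - h) * lN - (q + b) - (q + b) * l2) - ((q - h) * lq - q - q * l2))) + b * (lN - la)" for h
        by (simp add: algebra_simps)
      have "a / 2 * c + (a + 1) * b / 2 = a / 2 * (c + b) + b / 2" for c
        by (simp add: distrib_left distrib_right add_divide_distrib)
      moreover have "a / 2 * (c + b * (e + 1 / a)) = a / 2 * (c + b * e) + b / 2" for c e
        using that by (simp add: distrib_left)
      ultimately show ?thesis
        using shift[of "1 / 2"] by presburger
    qed
    have "real n \<noteq> 0" using two_le_n by simp
    from ring[OF this, of ?S "real p" "ln (real n)" "ln 2" ?q "ln ?q" "ln ?N"]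
    show ?thesis
      unfolding digamma_primitive_def ln2 N(3)[symmetric] .
  qed
  finally have "\<bar>drift n p\<bar> = real n / 2 * \<bar>(?S - (?G (n - 1) - ?G (n - 1 - p))) + ?r\<bar>"
    by (simp only: abs_mult abs_divide abs_numeral abs_of_nat)
  also have "\<dots> \<le> real n / 2 * (5 / ?q + 1 / ?q)"
    using 1 2 by (intro mult_left_mono order.trans[OF abs_triangle_ineq] add_mono) auto
  finally show ?thesis by simp
qed

text \<open>A quarter of Trigamma at m / 2 is close to 1 / (2 * m), hence to half of ln m - ln (m -
  1), and these logarithms telescope to the one in \<open>sigma2_LR\<close>. Replacing p / n by p /
  (n - 1) costs another 1 / (2 * q).\<close>

lemma abs_variance_sum_le: "\<bar>variance_sum n p / (real n)\<^sup>2 - sigma2_LR n p\<bar> \<le> 2 / real (n - 1 - p)"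
proof -
  let ?q = "real (n - 1 - p)" and ?N = "real (n - 1)"
  have N: "?N = real n - 1" "?N > 0" "?N = ?q + real p" using np by (auto simp: of_nat_diff)
  have "\<bar>Polygamma 1 (real (n - d) / 2) / 4 - (ln (real (n - d)) - ln (real (n - d - 1))) / 2\<bar>
      \<le> 3 / 2 * (1 / real (n - d - 1) - 1 / real (n - d))" if "d \<in> {1..p}" for d
  proof -
    define x where "x = real (n - d)"
    have x: "2 \<le> x" "real (n - d - 1) = x - 1"
      using that np by (auto simp: x_def of_nat_diff)
    have "ln (x - 1) \<le> ln x - 1 / x" "ln x \<le> ln (x - 1) + 1 / (x - 1)"
      using x ln_diff_le[of "x - 1" x] ln_diff_le[of x "x - 1"] by (simp_all add: diff_divide_distrib)
    moreover have "2 * (1 / x) \<le> Polygamma 1 (x / 2)" "Polygamma 1 (x / 2) \<le> 2 * (1 / x) + 4 * (1 / x\<^sup>2)"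
      using Trigamma_bounds[of "x / 2"] x by (auto simp: power_divide)
    moreover have "1 / x\<^sup>2 \<le> 1 / (x - 1) - 1 / x"
      using x(1) by (rule inverse_square_le_diff_inverse)
    moreover have "0 \<le> 1 / x\<^sup>2" by simp
    moreover have "\<bar>P / 4 - (l - l') / 2\<bar> \<le> 3 / 2 * (A - B)"
      if "l' \<le> l - B" "l \<le> l' + A" "2 * B \<le> P" "P \<le> 2 * B + 4 * W" "W \<le> A - B" "0 \<le> W"
      for P l l' A B W :: real
      using that unfolding abs_le_iff by (auto simp: diff_divide_distrib)
    ultimately show ?thesis
      unfolding x x_def[symmetric] by blast
  qed
  then have "\<bar>\<Sum>d\<in>{1..p}. Polygamma 1 (real (n - d) / 2) / 4 - (ln (real (n - d)) - ln (real (n - d - 1))) / 2\<bar>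
      \<le> (\<Sum>d\<in>{1..p}. 3 / 2 * (1 / real (n - d - 1) - 1 / real (n - d)))"
    by (intro order.trans[OF sum_abs] sum_mono)
  also have "\<dots> \<le> 3 / 2 * (1 / ?q)"
    unfolding sum_distrib_left[symmetric] using sum_inverse_le by simp
  also have "(\<Sum>d\<in>{1..p}. Polygamma 1 (real (n - d) / 2) / 4 - (ln (real (n - d)) - ln (real (n - d - 1))) / 2)
      = (\<Sum>d\<in>{1..p}. Polygamma 1 (real (n - d) / 2)) / 4 - (ln ?N - ln ?q) / 2"
    by (rule trans[OF sum_subtractf])
       (simp only: sum_divide_distrib[symmetric] sum_telescope_below[where f = "\<lambda>m. ln (real m)", OF Suc_lessD[OF np[unfolded Suc_eq_plus1[symmetric]]]])
  finally have 1: "\<bar>(\<Sum>d\<in>{1..p}. Polygamma 1 (real (n - d) / 2)) / 4 - (ln ?N - ln ?q) / 2\<bar> \<le> 3 / 2 * (1 / ?q)" .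
  have 2: "\<bar>real p / 2 * (1 / ?N - 1 / real n)\<bar> \<le> 1 / 2 * (1 / ?q)"
  proof -
    have eq: "real p / 2 * (1 / ?N - 1 / real n) = 1 / 2 * (real p / ?N * (1 / real n))"
    proof -
      have "1 / (a - 1) - 1 / a = 1 / (a - 1) * (1 / a)" if "1 < a" for a :: real
        using that by (subst diff_frac_eq) auto
      from this[of "real n"] have "1 / ?N - 1 / real n = 1 / ?N * (1 / real n)"
        using two_le_n unfolding N(1) by simp
      then show ?thesis by simp
    qed
    have "real p / ?N * (1 / real n) \<le> 1 * (1 / ?q)"
    proof (rule mult_mono)
      have "real p \<le> ?N" using np by simp
      then show "real p / ?N \<le> 1" using N(2) by (simp only: divide_le_eq_1_pos)
      show "1 / real n \<le> 1 / ?q" using np by (intro divide_left_mono) auto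
    qed auto
    moreover have "0 \<le> real p / ?N * (1 / real n)" by simp
    ultimately show ?thesis unfolding eq by simp
  qed
  have "variance_sum n p / (real n)\<^sup>2 - sigma2_LR n p
      = ((\<Sum>d\<in>{1..p}. Polygamma 1 (real (n - d) / 2)) / 4 - (ln ?N - ln ?q) / 2) + real p / 2 * (1 / ?N - 1 / real n)"
  proof -
    have ln_ratio: "ln (?q / ?N) = ln ?q - ln ?N" using N(2) codim_pos by (simp add: ln_div)
    have scaled: "variance_sum n p / (real n)\<^sup>2 = (\<Sum>d\<in>{1..p}. Polygamma 1 (real (n - d) / 2)) / 4 - real p / (2 * real n)"
      using two_le_n by (simp add: variance_sum_def diff_divide_distrib power2_eq_square)
    have ring: "s / 4 - b / (2 * a) - (- 1 / 2 * (b / c + (lq - lN))) = (s / 4 - (lN - lq) / 2) + b / 2 * (1 / c - 1 / a)"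
      for s a b c lq lN :: real
      by (simp add: right_diff_distrib diff_divide_distrib add_divide_distrib)
    show ?thesis
      unfolding sigma2_LR_def one_minus_ratio_eq unfolding N(1)[symmetric] ln_ratio scaled ring ..
  qed
  then have "\<bar>variance_sum n p / (real n)\<^sup>2 - sigma2_LR n p\<bar> \<le> 3 / 2 * (1 / ?q) + 1 / 2 * (1 / ?q)"
    by (simp only: order.trans[OF abs_triangle_ineq add_mono[OF 1 2]])
  moreover have "3 / 2 * a + 1 / 2 * a = 2 * a" for a :: real by simp
  ultimately show ?thesis by simp
qed

text \<open>The inverse squares telescope to 16 / q, so the Gamma part contributes 2 * n^3 / q; the
  other part is at most n^3 / q.\<close>

lemma third_bound_le: "third_bound n p \<le> 3 * (real n) ^ 3 / real (n - 1 - p)"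
proof -
  let ?q = "real (n - 1 - p)"
  have "(\<Sum>d\<in>{1..p}. 4 / (real (n - d) / 2)\<^sup>2) \<le> (\<Sum>d\<in>{1..p}. 16 * (1 / real (n - d - 1) - 1 / real (n - d)))"
  proof (rule sum_mono)
    fix d assume "d \<in> {1..p}"
    define x where "x = real (n - d)"
    have x: "2 \<le> x" "real (n - d - 1) = x - 1"
      using \<open>d \<in> {1..p}\<close> np by (auto simp: x_def of_nat_diff)
    have "1 / x\<^sup>2 \<le> 1 / (x - 1) - 1 / x"
      using x(1) by (rule inverse_square_le_diff_inverse)
    then show "4 / (real (n - d) / 2)\<^sup>2 \<le> 16 * (1 / real (n - d - 1) - 1 / real (n - d))"
      unfolding x x_def[symmetric] by (simp add: power_divide)
  qed
  also have "\<dots> \<le> 16 / ?q"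
    unfolding sum_distrib_left[symmetric] using sum_inverse_le by simp
  finally have "(real n / 2) ^ 3 * (\<Sum>d\<in>{1..p}. 4 / (real (n - d) / 2)\<^sup>2) \<le> (real n / 2) ^ 3 * (16 / ?q)"
    by (intro mult_left_mono) auto
  moreover have "real p * real n / 2 \<le> (real n) ^ 3 / ?q"
  proof -
    have "real p * real n * ?q \<le> real n * real n * real n"
      using np by (intro mult_mono) auto
    also have "\<dots> \<le> 2 * (real n * real n * real n)" by simp
    finally have "real p * real n / 2 * ?q \<le> (real n) ^ 3"
      by (simp add: power3_eq_cube)
    then show ?thesis using codim_pos by (simp add: pos_le_divide_eq)
  qed
  ultimately show ?thesis
    unfolding third_bound_def by (simp add: power_divide)
qed

end

text \<open>Written with \<open>ln_Gamma\<close> instead of a logarithm of the characteristic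
  function, so that no branch has to be chosen and each summand is differentiable along the real
  line. The constant has ln (n / 2) where the statistic has ln n: the p factors
  \<open>unit_powr v 2\<close> supply the ln 2.\<close>

definition log_char :: "nat \<Rightarrow> nat \<Rightarrow> complex \<Rightarrow> complex" where
  "log_char n p z = \<i> * z * of_real (real n * real p / 2 * (1 - ln (real n / 2)) - mu_LR n p)
     + (\<Sum>d\<in>{1..p}. ln_Gamma (of_real (real (n - d) / 2) + \<i> * z * of_real (real n / 2)) - ln_Gamma (of_real (real (n - d) / 2)))
     - of_real (real p * real n / 2) * ((1 + \<i> * z) * Ln (1 + \<i> * z))"

text \<open>For real z all Gamma arguments keep the real part (n - d) / 2, at least 1, and 1 + iz
  has norm at least 1, so the third derivative is bounded on the whole real line. Taylor's formula
  is therefore applied on the convex set of reals inside the complex plane.\<close>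

lemma log_char_Taylor:
  fixes u :: real
  assumes np: "p + 1 < n"
  shows "norm (log_char n p (of_real u) - (\<i> * of_real (drift n p * u) - of_real (variance_sum n p * u\<^sup>2 / 2)))
     \<le> third_bound n p * \<bar>u\<bar> ^ 3 / 2"
proof -
  define c where "c = real n * real p / 2 * (1 - ln (real n / 2)) - mu_LR n p"
  define k where "k = complex_of_real (real n / 2)"
  define A where "A d z = complex_of_real (real (n - d) / 2) + \<i> * z * k" for d z
  define P where "P = complex_of_real (real p * real n / 2)"
  \<comment> \<open>The function and its first three derivatives, as a sequence in the form that
    \<open>complex_Taylor\<close> expects.\<close>
  define f where "f i z = (if i = 0 then log_char n p z
      else if i = 1 then \<i> * of_real c + (\<Sum>d\<in>{1..p}. \<i> * k * Digamma (A d z)) - P * (\<i> * (Ln (1 + \<i> * z) + 1))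
      else if i = 2 then (\<Sum>d\<in>{1..p}. - k\<^sup>2 * Polygamma 1 (A d z)) + P / (1 + \<i> * z)
      else (\<Sum>d\<in>{1..p}. - \<i> * k ^ 3 * Polygamma 2 (A d z)) - \<i> * P / (1 + \<i> * z)\<^sup>2)" for i :: nat and z :: complex
  have Re_A: "Re (A d z) = real (n - d) / 2" if "z \<in> \<real>" for d z
    using that by (auto simp: A_def k_def elim!: Reals_cases)
  have A_pos: "0 < Re (A d z)" "1 \<le> Re (A d z)" if "z \<in> \<real>" "d \<in> {1..p}" for d z
    using that np by (auto simp: Re_A)
  have A_notin: "A d z \<notin> \<real>\<^sub>\<le>\<^sub>0" "A d z \<notin> \<int>\<^sub>\<le>\<^sub>0" if "z \<in> \<real>" "d \<in> {1..p}" for d z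
    using A_pos[OF that] nonpos_Ints_subset_nonpos_Reals by (auto simp: complex_nonpos_Reals_iff)
  have one: "1 + \<i> * z \<notin> \<real>\<^sub>\<le>\<^sub>0" "1 + \<i> * z \<noteq> 0" "1 \<le> norm (1 + \<i> * z)" if "z \<in> \<real>" for z
  proof -
    have "Re (1 + \<i> * z) = 1" using that by (auto elim!: Reals_cases)
    then show "1 + \<i> * z \<notin> \<real>\<^sub>\<le>\<^sub>0" "1 + \<i> * z \<noteq> 0" "1 \<le> norm (1 + \<i> * z)"
      using complex_Re_le_cmod[of "1 + \<i> * z"] by (auto simp: complex_nonpos_Reals_iff)
  qed
  have DA: "(A d has_field_derivative \<i> * k) (at z within \<real>)" for d z
    unfolding A_def by (auto intro!: derivative_eq_intros)
  have D_lin: "((\<lambda>z. 1 + \<i> * z) has_field_derivative \<i>) (at z within \<real>)" for z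
    by (auto intro!: derivative_eq_intros)
  have D_Ln: "((\<lambda>z. Ln (1 + \<i> * z)) has_field_derivative inverse (1 + \<i> * z) * \<i>) (at z within \<real>)" if "z \<in> \<real>" for z
    by (rule DERIV_chain2[OF has_field_derivative_Ln[OF one(1)[OF that]] D_lin])
  have D_entropy: "((\<lambda>z. (1 + \<i> * z) * Ln (1 + \<i> * z)) has_field_derivative \<i> * (Ln (1 + \<i> * z) + 1)) (at z within \<real>)"
    if "z \<in> \<real>" for z
  proof (rule DERIV_cong[OF DERIV_mult[OF D_lin D_Ln[OF that]]])
    have "inverse w * \<i> * w = \<i>" if "w \<noteq> 0" for w :: complex
      using that by (simp add: field_simps)
    from this[OF one(2)[OF that]]
    show "\<i> * Ln (1 + \<i> * z) + inverse (1 + \<i> * z) * \<i> * (1 + \<i> * z) = \<i> * (Ln (1 + \<i> * z) + 1)"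
      by (simp only: distrib_left mult_1_right)
  qed
  have D_inverse: "((\<lambda>z. P / (1 + \<i> * z)) has_field_derivative - (\<i> * P / (1 + \<i> * z)\<^sup>2)) (at z within \<real>)"
    if "z \<in> \<real>" for z
    using DERIV_divide[OF DERIV_const[of P] D_lin, of z] one(2)[OF that] by (simp add: power2_eq_square mult.commute)
  have D_Gamma: "((\<lambda>z. ln_Gamma (A d z) - c') has_field_derivative \<i> * k * Digamma (A d z)) (at z within \<real>)"
    if "z \<in> \<real>" "d \<in> {1..p}" for z d c'
    using DERIV_diff[OF DERIV_chain2[OF has_field_derivative_ln_Gamma_complex[OF A_notin(1)[OF that]] DA] DERIV_const[of c']]
    by (simp add: mult_ac)
  have D_Polygamma: "((\<lambda>z. Polygamma m (A d z)) has_field_derivative \<i> * k * Polygamma (Suc m) (A d z)) (at z within \<real>)"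
    if "z \<in> \<real>" "d \<in> {1..p}" for m z d
    using DERIV_chain2[OF has_field_derivative_Polygamma[OF A_notin(2)[OF that]] DA, of m] by (simp add: mult_ac)
  have D: "(f i has_field_derivative f (Suc i) z) (at z within \<real>)" if z: "z \<in> \<real>" and "i \<le> 2" for i z
  proof -
    consider "i = 0" | "i = 1" | "i = 2" using \<open>i \<le> 2\<close> by linarith
    then show ?thesis
    proof cases
      case 1
      have "f 0 = (\<lambda>z. \<i> * of_real c * z + (\<Sum>d\<in>{1..p}. ln_Gamma (A d z) - ln_Gamma (of_real (real (n - d) / 2)))
          - P * ((1 + \<i> * z) * Ln (1 + \<i> * z)))"
        by (simp add: f_def fun_eq_iff log_char_def A_def k_def P_def c_def)
      moreover have "f 1 z = \<i> * of_real c * 1 + (\<Sum>d\<in>{1..p}. \<i> * k * Digamma (A d z)) - P * (\<i> * (Ln (1 + \<i> * z) + 1))"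
        by (simp add: f_def)
      ultimately show ?thesis
        unfolding 1 One_nat_def[symmetric] using z
        by (simp only:) (intro DERIV_diff DERIV_add DERIV_sum DERIV_cmult DERIV_ident D_Gamma D_entropy)
    next
      case 2
      have "f 1 = (\<lambda>z. \<i> * of_real c + (\<Sum>d\<in>{1..p}. \<i> * k * Digamma (A d z)) - P * (\<i> * (Ln (1 + \<i> * z) + 1)))"
        by (simp add: f_def fun_eq_iff)
      moreover have "f 2 z = 0 + (\<Sum>d\<in>{1..p}. \<i> * k * (\<i> * k * Polygamma (Suc 0) (A d z))) - P * (\<i> * (inverse (1 + \<i> * z) * \<i> + 0))"
        by (simp add: f_def power2_eq_square mult_ac divide_inverse)
      moreover have "i = 1" "Suc i = 2" using 2 by auto
      ultimately show ?thesis
        using z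
        by (simp only:) (intro DERIV_diff DERIV_add DERIV_sum DERIV_cmult DERIV_const D_Polygamma D_Ln)
    next
      case 3
      have "f 2 = (\<lambda>z. (\<Sum>d\<in>{1..p}. - k\<^sup>2 * Polygamma 1 (A d z)) + P / (1 + \<i> * z))"
        by (simp add: f_def fun_eq_iff)
      moreover have "f 3 z = (\<Sum>d\<in>{1..p}. - k\<^sup>2 * (\<i> * k * Polygamma (Suc 1) (A d z))) + - (\<i> * P / (1 + \<i> * z)\<^sup>2)"
        by (simp add: f_def power2_eq_square power3_eq_cube numeral_2_eq_2 mult_ac)
      moreover have "i = 2" "Suc i = 3" using 3 by auto
      ultimately show ?thesis
        using z
        by (simp only:) (intro DERIV_add DERIV_sum DERIV_cmult D_Polygamma D_inverse)
    qed
  qed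
  have B: "norm (f (Suc 2) z) \<le> third_bound n p" if z: "z \<in> \<real>" for z
  proof -
    have "norm (\<Sum>d\<in>{1..p}. - \<i> * k ^ 3 * Polygamma 2 (A d z)) \<le> (\<Sum>d\<in>{1..p}. (real n / 2) ^ 3 * (4 / (real (n - d) / 2)\<^sup>2))"
    proof (rule sum_norm_le)
      fix d assume d: "d \<in> {1..p}"
      have "norm (- \<i> * k ^ 3 * Polygamma 2 (A d z)) = (real n / 2) ^ 3 * norm (Polygamma 2 (A d z))"
        by (simp add: norm_mult norm_power k_def norm_divide)
      also have "\<dots> \<le> (real n / 2) ^ 3 * (4 / (Re (A d z))\<^sup>2)"
        using norm_Tetragamma_le[OF A_pos(2)[OF z d]] by (intro mult_left_mono) auto
      finally show "norm (- \<i> * k ^ 3 * Polygamma 2 (A d z)) \<le> (real n / 2) ^ 3 * (4 / (real (n - d) / 2)\<^sup>2)"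
        by (simp only: Re_A[OF z])
    qed
    moreover have "norm (\<i> * P / (1 + \<i> * z)\<^sup>2) \<le> real p * real n / 2"
    proof -
      have "norm (\<i> * P / (1 + \<i> * z)\<^sup>2) = real p * real n / 2 / (norm (1 + \<i> * z))\<^sup>2"
        by (simp add: norm_mult norm_divide norm_power P_def)
      also have "\<dots> \<le> real p * real n / 2 / 1"
        using one(3)[OF z] by (intro divide_left_mono) (auto simp: one_le_power)
      finally show ?thesis by simp
    qed
    ultimately show ?thesis
      by (simp add: f_def third_bound_def sum_distrib_left norm_triangle_le_diff)
  qed
  \<comment> \<open>\<open>complex_Taylor\<close> has \<open>fact 2\<close> in the remainder, whence
    the division by 2 rather than 6 in the conclusion.\<close>
  have Taylor: "norm (f 0 (of_real u) - (\<Sum>i\<le>2. f i 0 * (of_real u - 0) ^ i / fact i)) \<le> third_bound n p * norm (complex_of_real u - 0) ^ Suc 2 / fact 2"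
    using D B by (intro complex_Taylor[where S = \<real>]) (auto intro: convex_Reals)
  have f0: "f 0 0 = 0"
    by (simp add: f_def log_char_def)
  have f1: "f 1 0 = \<i> * of_real (drift n p)"
  proof -
    have "Digamma (A d 0) = of_real (Digamma (real (n - d) / 2))" if "d \<in> {1..p}" for d
      using that np Polygamma_of_real[of "real (n - d) / 2" 0] by (simp add: A_def)
    then have "(\<Sum>d\<in>{1..p}. \<i> * k * Digamma (A d 0)) = \<i> * of_real (real n / 2 * (\<Sum>d\<in>{1..p}. Digamma (real (n - d) / 2)))"
      by (simp add: k_def sum_distrib_left mult.assoc)
    then show ?thesis
      by (simp add: f_def drift_def c_def P_def algebra_simps)
  qed
  have f2: "f 2 0 = - of_real (variance_sum n p)"
  proof -
    have "Polygamma 1 (A d 0) = of_real (Polygamma 1 (real (n - d) / 2))" if "d \<in> {1..p}" for d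
      using that np Polygamma_of_real[of "real (n - d) / 2" 1] by (simp add: A_def)
    then have "(\<Sum>d\<in>{1..p}. - k\<^sup>2 * Polygamma 1 (A d 0)) = - of_real ((real n)\<^sup>2 / 4 * (\<Sum>d\<in>{1..p}. Polygamma 1 (real (n - d) / 2)))"
      by (simp add: k_def sum_distrib_left sum_negf power_divide)
    then show ?thesis
      by (simp add: f_def variance_sum_def P_def)
  qed
  have "(\<Sum>i\<le>2. f i 0 * (of_real u - 0) ^ i / fact i) = \<i> * of_real (drift n p * u) - of_real (variance_sum n p * u\<^sup>2 / 2)"
    using f0 f1 f2 by (simp add: numeral_2_eq_2 power2_eq_square)
  moreover have "f 0 (of_real u) = log_char n p (of_real u)" by (simp add: f_def)
  moreover have "third_bound n p * norm (complex_of_real u - 0) ^ Suc 2 / fact 2 = third_bound n p * \<bar>u\<bar> ^ 3 / 2"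
    by (simp add: numeral_3_eq_3 numeral_2_eq_2)
  ultimately show ?thesis using Taylor by (simp only:)
qed

text \<open>At u = t / (n * sigma) the powers of n cancel in all three errors, and each retains the
  factor 1 / ((n - 1 - p) * sigma). The rest depends on t and on inverse powers of sigma, harmless
  once sigma is bounded below.\<close>

lemma norm_log_char_le:
  assumes np: "p + 1 < n" and \<sigma>: "\<sigma> = sqrt (sigma2_LR n p)" "0 < \<sigma>"
  shows "norm (log_char n p (of_real (t / (real n * \<sigma>))) - of_real (- t\<^sup>2 / 2))
     \<le> 1 / (real (n - 1 - p) * \<sigma>) * (3 * \<bar>t\<bar> + t\<^sup>2 / \<sigma> + 2 * \<bar>t\<bar> ^ 3 / \<sigma>\<^sup>2)"
proof -
  let ?q = "real (n - 1 - p)" and ?u = "t / (real n * \<sigma>)"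
  define r where "r = 1 / (?q * \<sigma>)"
  have q: "0 < ?q" and n: "0 < real n" using np by auto
  have \<sigma>2: "\<sigma>\<^sup>2 = sigma2_LR n p"
    using \<sigma> by (simp add: order_less_imp_le)
  have abs_u: "\<bar>?u\<bar> = \<bar>t\<bar> / (real n * \<sigma>)" using n \<sigma>(2) by (simp add: abs_divide)
  have r: "0 < r" using q \<sigma>(2) by (simp add: r_def)
  have "norm (\<i> * of_real (drift n p * ?u)) = \<bar>drift n p\<bar> * \<bar>?u\<bar>"
    by (simp only: norm_mult norm_ii norm_of_real abs_mult mult_1)
  also have "\<dots> \<le> 3 * real n / ?q * \<bar>?u\<bar>"
    using abs_drift_le[OF np] by (rule mult_right_mono) simp
  also have "\<dots> = r * (3 * \<bar>t\<bar>)"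
    unfolding abs_u r_def using n by simp
  finally have 1: "norm (\<i> * of_real (drift n p * ?u)) \<le> r * (3 * \<bar>t\<bar>)" .
  have "variance_sum n p * ?u\<^sup>2 / 2 - t\<^sup>2 / 2 = (variance_sum n p / (real n)\<^sup>2 - \<sigma>\<^sup>2) * (t\<^sup>2 / (2 * \<sigma>\<^sup>2))"
  proof -
    have "\<sigma>\<^sup>2 * (t\<^sup>2 / (2 * \<sigma>\<^sup>2)) = t\<^sup>2 / 2" using \<sigma>(2) by simp
    moreover have "variance_sum n p * ?u\<^sup>2 / 2 = variance_sum n p / (real n)\<^sup>2 * (t\<^sup>2 / (2 * \<sigma>\<^sup>2))"
      by (simp add: power_divide power_mult_distrib)
    ultimately show ?thesis by (simp only: left_diff_distrib)
  qed
  then have "\<bar>variance_sum n p * ?u\<^sup>2 / 2 - t\<^sup>2 / 2\<bar> = \<bar>variance_sum n p / (real n)\<^sup>2 - \<sigma>\<^sup>2\<bar> * (t\<^sup>2 / (2 * \<sigma>\<^sup>2))"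
    by (simp add: abs_mult)
  also have "\<dots> \<le> 2 / ?q * (t\<^sup>2 / (2 * \<sigma>\<^sup>2))"
    using abs_variance_sum_le[OF np] unfolding \<sigma>2[symmetric] by (rule mult_right_mono) simp
  also have "\<dots> = r * (t\<^sup>2 / \<sigma>)"
    by (simp add: r_def power2_eq_square)
  finally have 2: "\<bar>variance_sum n p * ?u\<^sup>2 / 2 - t\<^sup>2 / 2\<bar> \<le> r * (t\<^sup>2 / \<sigma>)" .
  have "third_bound n p * \<bar>?u\<bar> ^ 3 / 2 \<le> 3 * (real n) ^ 3 / ?q * \<bar>?u\<bar> ^ 3 / 2"
    using third_bound_le[OF np] by (intro divide_right_mono mult_right_mono) auto
  also have "\<dots> = r * (3 / 2 * \<bar>t\<bar> ^ 3 / \<sigma>\<^sup>2)"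
    unfolding abs_u r_def power_divide power_mult_distrib using n by (simp add: power2_eq_square power3_eq_cube)
  also have "\<dots> \<le> r * (2 * \<bar>t\<bar> ^ 3 / \<sigma>\<^sup>2)"
    using r by (intro mult_left_mono divide_right_mono mult_right_mono) auto
  finally have 3: "third_bound n p * \<bar>?u\<bar> ^ 3 / 2 \<le> r * (2 * \<bar>t\<bar> ^ 3 / \<sigma>\<^sup>2)" .
  let ?L = "log_char n p (of_real ?u)" and ?D = "\<i> * of_real (drift n p * ?u)"
    and ?V = "variance_sum n p * ?u\<^sup>2 / 2"
  have "norm (?L - of_real (- t\<^sup>2 / 2)) = norm ((?L - (?D - of_real ?V)) + (?D - of_real (?V - t\<^sup>2 / 2)))"
    by simp
  also have "\<dots> \<le> norm (?L - (?D - of_real ?V)) + (norm ?D + norm (of_real (?V - t\<^sup>2 / 2) :: complex))"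
    by (intro order.trans[OF norm_triangle_ineq] add_left_mono norm_triangle_ineq4)
  also have "\<dots> \<le> r * (2 * \<bar>t\<bar> ^ 3 / \<sigma>\<^sup>2) + (r * (3 * \<bar>t\<bar>) + r * (t\<^sup>2 / \<sigma>))"
    using order.trans[OF log_char_Taylor[OF np, of ?u] 3] 1 2 by (intro add_mono) (simp_all only: norm_of_real)
  also have "\<dots> = r * (3 * \<bar>t\<bar> + t\<^sup>2 / \<sigma> + 2 * \<bar>t\<bar> ^ 3 / \<sigma>\<^sup>2)"
    by (simp only: distrib_left add_ac)
  finally show ?thesis unfolding r_def .
qed

text \<open>The linear terms cancel and the quadratic term of -ln (1 - x) remains. For p > 0 this is
  the positivity of the variance.\<close>

lemma sigma2_LR_ge:
  assumes "p + 1 < n"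
  shows "(real p / real n)\<^sup>2 / 4 \<le> sigma2_LR n p"
proof -
  let ?x = "real p / (real n - 1)"
  have x: "0 \<le> ?x" "?x < 1" using assms by (auto simp: divide_simps)
  have "real p / real n \<le> ?x" using assms by (intro divide_left_mono) auto
  then have "(real p / real n)\<^sup>2 \<le> ?x\<^sup>2" by (intro power_mono) auto
  moreover have "?x + ?x\<^sup>2 / 2 \<le> - ln (1 - ?x)" using ln_one_minus_bounds(1)[OF x] .
  moreover have "a / 4 \<le> - 1 / 2 * (x + l)" if "x + s / 2 \<le> - l" "a \<le> s" for a s x l :: real
    using that by (auto simp: field_simps)
  ultimately show ?thesis unfolding sigma2_LR_def by blast
qed

context
  fixes p :: "nat \<Rightarrow> nat" and y :: real
  assumes p_less: "\<And>n. 3 \<le> n \<Longrightarrow> p n + 1 < n"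
    and p_lim: "(\<lambda>n. real (p n) / real n) \<longlonglongrightarrow> y" and y: "0 < y" "y \<le> 1"
begin

text \<open>Eventually p / n exceeds y / 2, and (y / 2)^2 / 4 is (y / 4)^2.\<close>

lemma eventually_sigma_ge:
  "\<forall>\<^sub>F n in sequentially. y / 4 \<le> sqrt (sigma2_LR n (p n))"
proof -
  have "\<forall>\<^sub>F n in sequentially. y / 2 < real (p n) / real n"
    using p_lim y by (intro order_tendstoD) auto
  then show ?thesis
    using eventually_ge_at_top[of 3]
  proof eventually_elim
    case (elim n)
    have "(y / 2)\<^sup>2 \<le> (real (p n) / real n)\<^sup>2"
      using elim y by (intro power_mono) auto
    moreover have "(y / 4)\<^sup>2 = (y / 2)\<^sup>2 / 4" by (simp add: power_divide)
    ultimately have "(y / 4)\<^sup>2 \<le> sigma2_LR n (p n)"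
      using sigma2_LR_ge[OF p_less[OF elim(2)]] by linarith
    then show ?case by (rule real_le_rsqrt)
  qed
qed

text \<open>For y < 1 the first factor grows like (1 - y) * n while sigma is bounded below. For y =
  1 the first factor is only known to be at least 1, but p / (n - 1) tends to 1 from below, so the
  logarithm drives sigma to infinity.\<close>

lemma filterlim_codim_sigma:
  "filterlim (\<lambda>n. real (n - 1 - p n) * sqrt (sigma2_LR n (p n))) at_top sequentially"
proof (cases "y < 1")
  case True
  have "(\<lambda>n. 1 - 1 / real n - real (p n) / real n) \<longlonglongrightarrow> 1 - 0 - y"
    by (intro tendsto_intros p_lim lim_1_over_n)
  then have "filterlim (\<lambda>n. (1 - 1 / real n - real (p n) / real n) * real n) at_top sequentially"
    using True by (intro filterlim_tendsto_pos_mult_at_top filterlim_real_sequentially) auto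
  moreover have "\<forall>\<^sub>F n in sequentially. (1 - 1 / real n - real (p n) / real n) * real n = real (n - 1 - p n)"
    using eventually_ge_at_top[of 3]
  proof eventually_elim
    case (elim n)
    then show ?case using p_less[of n] by (simp add: left_diff_distrib of_nat_diff)
  qed
  ultimately have "filterlim (\<lambda>n. real (n - 1 - p n)) at_top sequentially"
    by (rule iffD1[OF filterlim_cong[OF refl refl], rotated])
  then have "filterlim (\<lambda>n. y / 4 * real (n - 1 - p n)) at_top sequentially"
    using y by (intro filterlim_tendsto_pos_mult_at_top[OF tendsto_const]) auto
  moreover have "\<forall>\<^sub>F n in sequentially. y / 4 * real (n - 1 - p n) \<le> real (n - 1 - p n) * sqrt (sigma2_LR n (p n))"
    using eventually_sigma_ge
  proof eventually_elim
    case (elim n)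
    have "real (n - 1 - p n) * (y / 4) \<le> real (n - 1 - p n) * sqrt (sigma2_LR n (p n))"
      by (rule mult_left_mono[OF elim]) simp
    then show ?case by (simp only: mult.commute)
  qed
  ultimately show ?thesis by (rule filterlim_at_top_mono)
next
  case False
  then have "y = 1" using y by simp
  let ?x = "\<lambda>n. real (p n) / (real n - 1)"
  have "(\<lambda>n. real (p n) / real n * (real n / (real n - 1))) \<longlonglongrightarrow> y * 1"
  proof (intro tendsto_mult p_lim)
    show "(\<lambda>n. real n / (real n - 1)) \<longlonglongrightarrow> 1" by real_asymp
  qed
  moreover have "\<forall>\<^sub>F n in sequentially. real (p n) / real n * (real n / (real n - 1)) = ?x n"
    using eventually_ge_at_top[of 3] by eventually_elim (simp only: times_divide_times_eq, simp)
  ultimately have "?x \<longlonglongrightarrow> y * 1"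
    by (rule Lim_transform_eventually)
  then have x: "?x \<longlonglongrightarrow> 1"
    using \<open>y = 1\<close> by simp
  have x_less: "\<forall>\<^sub>F n in sequentially. 0 < 1 - ?x n"
    using eventually_ge_at_top[of 3]
  proof eventually_elim
    case (elim n)
    then show ?case using p_less[of n] by (simp add: divide_simps)
  qed
  have "(\<lambda>n. 1 - ?x n) \<longlonglongrightarrow> 1 - 1"
    by (intro tendsto_intros x)
  then have "filterlim (\<lambda>n. 1 - ?x n) (at_right 0) sequentially"
    using x_less by (intro tendsto_imp_filterlim_at_right) simp_all
  then have "filterlim (\<lambda>n. ln (1 - ?x n)) at_bot sequentially"
    by (rule filterlim_compose[OF ln_at_0])
  then have "filterlim (\<lambda>n. - ln (1 - ?x n)) at_top sequentially"
    by (simp add: filterlim_uminus_at_bot)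
  then have "filterlim (\<lambda>n. - ?x n + - ln (1 - ?x n)) at_top sequentially"
    by (intro filterlim_tendsto_add_at_top[OF tendsto_minus[OF x]])
  then have "filterlim (\<lambda>n. 1 / 2 * (- ?x n + - ln (1 - ?x n))) at_top sequentially"
    by (intro filterlim_tendsto_pos_mult_at_top[OF tendsto_const]) auto
  also have "(\<lambda>n. 1 / 2 * (- ?x n + - ln (1 - ?x n))) = (\<lambda>n. sigma2_LR n (p n))"
  proof -
    have "1 / 2 * (- a + - b) = - 1 / 2 * (a + b)" for a b :: real
      by (simp only: distrib_left)
    then show ?thesis unfolding sigma2_LR_def by (simp only:)
  qed
  finally have "filterlim (\<lambda>n. sqrt (sigma2_LR n (p n))) at_top sequentially"
    by (rule filterlim_compose[OF sqrt_at_top])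
  moreover have "\<forall>\<^sub>F n in sequentially. sqrt (sigma2_LR n (p n)) \<le> real (n - 1 - p n) * sqrt (sigma2_LR n (p n))"
    using eventually_ge_at_top[of 3] eventually_sigma_ge
  proof eventually_elim
    case (elim n)
    have "1 \<le> real (n - 1 - p n)" using p_less[OF elim(1)] by simp
    then have "1 * sqrt (sigma2_LR n (p n)) \<le> real (n - 1 - p n) * sqrt (sigma2_LR n (p n))"
      by (rule mult_right_mono) (use elim(2) y in linarith)
    then show ?case by (simp only: mult_1)
  qed
  ultimately show ?thesis by (rule filterlim_at_top_mono)
qed

lemma tendsto_log_char:
  "(\<lambda>n. log_char n (p n) (of_real (t / (real n * sqrt (sigma2_LR n (p n)))))) \<longlonglongrightarrow> of_real (- t\<^sup>2 / 2)"
proof -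
  let ?\<sigma> = "\<lambda>n. sqrt (sigma2_LR n (p n))"
  let ?C = "3 * \<bar>t\<bar> + t\<^sup>2 / (y / 4) + 2 * \<bar>t\<bar> ^ 3 / (y / 4)\<^sup>2"
  have "(\<lambda>n. 1 / (real (n - 1 - p n) * ?\<sigma> n) * ?C) \<longlonglongrightarrow> 0 * ?C"
    using filterlim_codim_sigma
    by (intro tendsto_mult tendsto_const tendsto_divide_0[OF tendsto_const] filterlim_at_top_imp_at_infinity)
  moreover have "\<forall>\<^sub>F n in sequentially. norm (log_char n (p n) (of_real (t / (real n * ?\<sigma> n))) - of_real (- t\<^sup>2 / 2))
      \<le> 1 / (real (n - 1 - p n) * ?\<sigma> n) * ?C"
    using eventually_ge_at_top[of 3] eventually_sigma_ge
  proof eventually_elim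
    case (elim n)
    have \<sigma>: "0 < ?\<sigma> n" using elim(2) y by linarith
    have "(y / 4)\<^sup>2 \<le> (?\<sigma> n)\<^sup>2" using elim(2) y by (intro power_mono) auto
    then have "3 * \<bar>t\<bar> + t\<^sup>2 / ?\<sigma> n + 2 * \<bar>t\<bar> ^ 3 / (?\<sigma> n)\<^sup>2 \<le> ?C"
      using elim(2) y \<sigma> by (intro add_mono divide_left_mono order_refl) auto
    then show ?case
      by (rule order.trans[OF norm_log_char_le[OF p_less[OF elim(1)] refl \<sigma>] mult_left_mono]) (use \<sigma> in simp)
  qed
  ultimately have "(\<lambda>n. log_char n (p n) (of_real (t / (real n * ?\<sigma> n))) - of_real (- t\<^sup>2 / 2)) \<longlonglongrightarrow> 0"
    unfolding mult_zero_left by (rule Lim_null_comparison[rotated])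
  then show ?thesis by (rule LIM_zero_cancel)
qed

text \<open>Provides the condition \<open>\<bar>u\<bar> < 1\<close> under which the characteristic
  function was computed.\<close>

lemma eventually_argument_small:
  "\<forall>\<^sub>F n in sequentially. \<bar>t / (real n * sqrt (sigma2_LR n (p n)))\<bar> < 1"
proof -
  have "(\<lambda>n. \<bar>t\<bar> / (y / 4) * (1 / real n)) \<longlonglongrightarrow> \<bar>t\<bar> / (y / 4) * 0"
    by (intro tendsto_intros lim_1_over_n)
  then have "(\<lambda>n. \<bar>t\<bar> / (real n * (y / 4))) \<longlonglongrightarrow> 0"
    by (simp add: mult.commute)
  then have "\<forall>\<^sub>F n in sequentially. \<bar>t\<bar> / (real n * (y / 4)) < 1"
    by (rule order_tendstoD) simp
  then show ?thesis
    using eventually_ge_at_top[of 3] eventually_sigma_ge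
  proof eventually_elim
    case (elim n)
    have \<sigma>: "0 < sqrt (sigma2_LR n (p n))" using elim(3) y by linarith
    then have "\<bar>t / (real n * sqrt (sigma2_LR n (p n)))\<bar> = \<bar>t\<bar> / (real n * sqrt (sigma2_LR n (p n)))"
      by (simp only: abs_divide abs_mult abs_of_nat abs_of_pos)
    also have "\<dots> \<le> \<bar>t\<bar> / (real n * (y / 4))"
    proof (rule divide_left_mono)
      show "0 < real n * sqrt (sigma2_LR n (p n)) * (real n * (y / 4))"
        using elim(2) y \<sigma> by (intro mult_pos_pos) auto
    qed (use elim in \<open>auto intro: mult_left_mono\<close>)
    finally show ?case using elim(1) by linarith
  qed
qed

end

section \<open>The central limit theorem\<close>

text \<open>With v = u * n / 2 the exponent n / 2 + iv equals n / 2 * (1 + iu), which turns each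
  power of 1 + iu into the entropy-like term of \<open>log_char\<close>.\<close>

lemma prod_chisq_factor_eq_exp_log_char:
  assumes np: "p + 1 < n"
  shows "exp (- \<i> * of_real (u * mu_LR n p)) * exp (\<i> * of_real (u * (real n * real p / 2 * (1 - ln (real n)))))
      * (\<Prod>d\<in>{1..p}. chisq_factor n d (u * (real n / 2)) u) = exp (log_char n p (of_real u))"
proof -
  let ?w = "1 + \<i> * complex_of_real u" and ?v = "u * (real n / 2)"
  define D where "D d = ln_Gamma (of_real (real (n - d) / 2) + \<i> * of_real u * of_real (real n / 2))
      - ln_Gamma (complex_of_real (real (n - d) / 2))" for d
  define E where "E = \<i> * of_real (?v * ln 2) - of_real (real n / 2) * (?w * Ln ?w)"
  have Gamma_exp: "Gamma z = exp (ln_Gamma z)" if "0 < Re z" for z :: complex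
  proof -
    have "z \<notin> \<int>\<^sub>\<le>\<^sub>0" using that by (auto elim!: nonpos_Ints_cases')
    then show ?thesis by (simp add: Gamma_complex_altdef)
  qed
  have "chisq_factor n d ?v u = exp (D d + E)" if "d \<in> {1..p}" for d
  proof -
    let ?a = "complex_of_real (real (n - d) / 2)"
    have a: "0 < Re ?a" "0 < Re (?a + \<i> * of_real ?v)" using that np by auto
    have "?w \<noteq> 0" by (simp add: complex_eq_iff)
    then have "?w powr (- (of_nat n / 2 + \<i> * of_real ?v)) = exp (- (of_real (real n / 2) * (?w * Ln ?w)))"
      by (simp add: powr_def algebra_simps)
    moreover have "unit_powr ?v 2 = exp (\<i> * of_real (?v * ln 2))"
      by (simp add: unit_powr_def)
    moreover have "Gamma (?a + \<i> * of_real ?v) / Gamma ?a = exp (D d)"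
      unfolding Gamma_exp[OF a(1)] Gamma_exp[OF a(2)] D_def exp_diff by (simp add: mult_ac)
    ultimately show ?thesis
      unfolding chisq_factor_def E_def exp_add exp_diff times_divide_eq_right[symmetric] exp_minus divide_inverse[of "exp (\<i> * _)"]
      by (simp only: mult_ac)
  qed
  then have "(\<Prod>d\<in>{1..p}. chisq_factor n d ?v u) = exp (\<Sum>d\<in>{1..p}. D d + E)"
    by (simp add: exp_sum)
  also have "(\<Sum>d\<in>{1..p}. D d + E) = (\<Sum>d\<in>{1..p}. D d) + of_nat p * E"
    by (simp add: sum.distrib)
  finally have prod: "(\<Prod>d\<in>{1..p}. chisq_factor n d ?v u) = exp ((\<Sum>d\<in>{1..p}. D d) + of_nat p * E)" .
  have ln2: "ln (real n / 2) = ln (real n) - ln 2" using np by (simp add: ln_div)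
  have "- \<i> * of_real (u * mu_LR n p) + \<i> * of_real (u * (real n * real p / 2 * (1 - ln (real n))))
      + ((\<Sum>d\<in>{1..p}. D d) + of_nat p * E) = log_char n p (of_real u)"
    unfolding log_char_def D_def[symmetric] E_def ln2 by (simp add: algebra_simps diff_divide_distrib add_divide_distrib)
  then show ?thesis
    unfolding prod by (simp only: exp_add[symmetric])
qed

section \<open>The statistic as a measurable function of the Gaussian sample\<close>

lemma sum_squares_decomposition:
  assumes "n > 0"
  shows "mat_trace p (scatter_mat n p x) + real n * (\<Sum>j<p. (sample_mean n x j)\<^sup>2) = (\<Sum>j<p. \<Sum>i<n. (x i j)\<^sup>2)"
proof -
  have "(\<Sum>i<n. (x i j - sample_mean n x j) * (x i j - sample_mean n x j)) + real n * (sample_mean n x j)\<^sup>2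
      = (\<Sum>i<n. (x i j)\<^sup>2)" for j
  proof -
    let ?m = "sample_mean n x j"
    have "(\<Sum>i<n. x i j) = real n * ?m" using assms by (simp add: sample_mean_def)
    moreover have "(\<Sum>i<n. (x i j - ?m) * (x i j - ?m)) = (\<Sum>i<n. (x i j)\<^sup>2 - 2 * ?m * x i j + ?m\<^sup>2)"
      by (intro sum.cong) (auto simp: power2_eq_square algebra_simps)
    moreover have "\<dots> = (\<Sum>i<n. (x i j)\<^sup>2) - 2 * ?m * (\<Sum>i<n. x i j) + real n * ?m\<^sup>2"
      by (simp add: sum.distrib sum_subtractf sum_distrib_left)
    ultimately show ?thesis by (simp add: power2_eq_square)
  qed
  then show ?thesis
    by (simp add: mat_trace_def scatter_mat_def sum_distrib_left sum.distrib[symmetric])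
qed

text \<open>For a singular scatter matrix \<open>LR_stat\<close> is 0 and its logarithm a default
  value; positivity of the determinant holds almost surely.\<close>

lemma ln_LR_stat:
  assumes "n > 0" and det: "0 < det (scatter_mat n p x)"
  shows "ln (LR_stat n p x) = real n * real p / 2 * (1 - ln (real n)) + real n / 2 * ln (det (scatter_mat n p x))
     - (\<Sum>j<p. \<Sum>i<n. (x i j)\<^sup>2) / 2"
proof -
  let ?D = "det (scatter_mat n p x)" and ?m = "\<Sum>j<p. (sample_mean n x j)\<^sup>2"
  have "LR_stat n p x = exp (real n * real p / 2 * (1 - ln (real n))) * exp (real n / 2 * ln ?D)
      * exp (- mat_trace p (scatter_mat n p x) / 2) * exp (- real n * ?m / 2)"
    using assms by (simp add: LR_stat_def powr_def ln_div)
  also have "\<dots> = exp (real n * real p / 2 * (1 - ln (real n)) + real n / 2 * ln ?D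
      + - mat_trace p (scatter_mat n p x) / 2 + - real n * ?m / 2)"
    by (simp only: exp_add)
  finally show ?thesis
    using sum_squares_decomposition[OF assms(1), of p x] by (simp add: add_divide_distrib[symmetric])
qed

lemma LR_stat_cong:
  assumes "\<And>i j. i < n \<Longrightarrow> j < p \<Longrightarrow> x i j = x' i j"
  shows "LR_stat n p x = LR_stat n p x'"
proof -
  have mean: "sample_mean n x j = sample_mean n x' j" if "j < p" for j
    using that assms by (simp add: sample_mean_def)
  have "scatter_mat n p x = scatter_mat n p x'"
    unfolding scatter_mat_def using assms by (intro eq_matI) (auto simp: mean)
  then show ?thesis by (simp add: LR_stat_def mean)
qed

lemma measurable_LR_stat:
  assumes X: "\<And>i j. i < n \<Longrightarrow> j < p \<Longrightarrow> (\<lambda>\<omega>. X \<omega> i j) \<in> borel_measurable M"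
  shows "(\<lambda>\<omega>. LR_stat n p (X \<omega>)) \<in> borel_measurable M"
proof -
  have mean: "(\<lambda>\<omega>. sample_mean n (X \<omega>) j) \<in> borel_measurable M" if "j < p" for j
    unfolding sample_mean_def using X that by (intro borel_measurable_divide borel_measurable_sum) auto
  have "(\<lambda>\<omega>. det (scatter_mat n p (X \<omega>))) \<in> borel_measurable M"
    using measurable_gram_det[of p n "\<lambda>\<omega> j i. X \<omega> i j - sample_mean n (X \<omega>) j" M] X mean
    by (simp add: gram_det_def scatter_mat_def)
  moreover have "(\<lambda>\<omega>. mat_trace p (scatter_mat n p (X \<omega>))) \<in> borel_measurable M"
  proof -
    have "(\<lambda>\<omega>. mat_trace p (scatter_mat n p (X \<omega>)))
        = (\<lambda>\<omega>. \<Sum>j<p. \<Sum>i<n. (X \<omega> i j - sample_mean n (X \<omega>) j) * (X \<omega> i j - sample_mean n (X \<omega>) j))"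
      by (simp add: mat_trace_def scatter_mat_def)
    then show ?thesis
      using X mean by (simp only:) (intro borel_measurable_sum borel_measurable_times borel_measurable_diff; simp)
  qed
  moreover have "(\<lambda>\<omega>. \<Sum>j<p. (sample_mean n (X \<omega>) j)\<^sup>2) \<in> borel_measurable M"
    using mean by (intro borel_measurable_sum borel_measurable_power) auto
  ultimately show ?thesis
    unfolding LR_stat_def by measurable
qed

text \<open>The case \<open>u = v = 0\<close> of the product formula computes the probability that the determinant is positive.\<close>

lemma AE_gauss_det_scatter_pos:
  assumes np: "p + 1 < n"
  shows "AE x in gauss ({..<n} \<times> {..<p}). 0 < det (scatter_mat n p (\<lambda>i j. x (i, j)))"
proof -
  let ?G = "gauss ({..<n} \<times> {..<p})"
  interpret prob_space ?G by (rule prob_space_gauss)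
  let ?A = "{x \<in> space ?G. 0 < gram_det n (Suc p) (augment x)}"
  have A: "?A \<in> sets ?G"
    using measurable_augmented_gram_det[of n p "{..<n} \<times> {..<p}"] by measurable
  have factor: "chisq_factor n d 0 0 = 1" if "d \<in> {1..p}" for d
  proof -
    have "Gamma (complex_of_real (real (n - d) / 2)) \<noteq> 0"
      using that np by (auto simp: Gamma_complex_of_real simp del: of_real_divide intro!: less_imp_neq[OF Gamma_real_pos, symmetric])
    then show ?thesis by (simp add: chisq_factor_def unit_powr_def)
  qed
  have "of_real (prob ?A) = (\<integral>x. complex_of_real (indicator ?A x) \<partial>?G)"
    using A by simp
  also have "\<dots> = (\<integral>x. unit_powr 0 (gram_det n (Suc p) (augment x)) * exp (- \<i> * of_real (0 * ((\<Sum>k\<in>{..<n} \<times> {..<p}. (x k)\<^sup>2) / 2))) \<partial>?G)"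
    by (intro Bochner_Integration.integral_cong refl) (auto simp: unit_powr_def indicator_def)
  also have "\<dots> = unit_powr 0 (real n) * (\<Prod>d\<in>{1..p}. chisq_factor n d 0 0)"
    using np by (intro integral_gauss_gram_det) auto
  also have "\<dots> = 1"
    using np factor by (simp add: unit_powr_def)
  finally have "prob ?A = 1" by (simp only: of_real_eq_1_iff)
  then have "AE x in ?G. x \<in> ?A"
    using A by (simp add: prob_eq_1)
  then show ?thesis
    by eventually_elim (use np in \<open>simp add: gram_det_augment zero_less_mult_iff\<close>)
qed

text \<open>Almost surely the integrand is a constant times the one of the Gram determinant formula.
  The Gram determinant is n times the scatter determinant, so \<open>unit_powr v n\<close> is
  divided out and reappears from the product formula.\<close>

lemma integral_gauss_exp_LR_stat:
  assumes np: "p + 1 < n" and s: "s \<noteq> 0" "\<bar>t / s\<bar> < 1"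
  shows "(\<integral>x. exp (\<i> * of_real (t * ((ln (LR_stat n p (\<lambda>i j. x (i, j))) - mu_LR n p) / s))) \<partial>gauss ({..<n} \<times> {..<p}))
       = exp (log_char n p (of_real (t / s)))"
proof -
  let ?G = "gauss ({..<n} \<times> {..<p})" and ?u = "t / s"
  let ?det = "\<lambda>x::nat \<times> nat \<Rightarrow> real. det (scatter_mat n p (\<lambda>i j. x (i, j)))"
  let ?c = "exp (- \<i> * of_real (?u * mu_LR n p)) * exp (\<i> * of_real (?u * (real n * real p / 2 * (1 - ln (real n)))))"
  let ?e = "\<lambda>x. exp (- \<i> * complex_of_real (?u * ((\<Sum>k\<in>{..<n} \<times> {..<p}. (x k)\<^sup>2) / 2)))"
  let ?v = "?u * (real n / 2)"
  have n: "n > 0" using np by simp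
  have coordinates: "(\<lambda>x. x (i, j)) \<in> borel_measurable ?G" if "i < n" "j < p" for i j
    using that by (intro measurable_gauss_component) auto
  have "(\<integral>x. exp (\<i> * of_real (t * ((ln (LR_stat n p (\<lambda>i j. x (i, j))) - mu_LR n p) / s))) \<partial>?G)
      = (\<integral>x. ?c / unit_powr ?v (real n) * (unit_powr ?v (gram_det n (Suc p) (augment x)) * ?e x) \<partial>?G)"
  proof (rule integral_cong_AE)
    have LR: "(\<lambda>x. LR_stat n p (\<lambda>i j. x (i, j))) \<in> borel_measurable ?G"
      by (rule measurable_LR_stat) (rule coordinates)
    then show "(\<lambda>x. exp (\<i> * of_real (t * ((ln (LR_stat n p (\<lambda>i j. x (i, j))) - mu_LR n p) / s)))) \<in> borel_measurable ?G"
      by measurable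
    have "(\<lambda>x. unit_powr ?v (gram_det n (Suc p) (augment x))) \<in> borel_measurable ?G"
      by (rule measurable_compose[OF measurable_augmented_gram_det measurable_unit_powr]) auto
    moreover have "(\<lambda>x. \<Sum>k\<in>{..<n} \<times> {..<p}. (x k)\<^sup>2) \<in> borel_measurable ?G"
      by (intro borel_measurable_sum borel_measurable_power measurable_gauss_component)
    ultimately show "(\<lambda>x. ?c / unit_powr ?v (real n) * (unit_powr ?v (gram_det n (Suc p) (augment x)) * ?e x)) \<in> borel_measurable ?G"
      by measurable
    show "AE x in ?G. exp (\<i> * of_real (t * ((ln (LR_stat n p (\<lambda>i j. x (i, j))) - mu_LR n p) / s)))
        = ?c / unit_powr ?v (real n) * (unit_powr ?v (gram_det n (Suc p) (augment x)) * ?e x)"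
      using AE_gauss_det_scatter_pos[OF np]
    proof eventually_elim
      case (elim x)
      have "(\<Sum>j<p. \<Sum>i<n. (x (i, j))\<^sup>2) = (\<Sum>k\<in>{..<n} \<times> {..<p}. (x k)\<^sup>2)"
        by (subst sum.swap) (simp add: sum.cartesian_product split_beta')
      then have "t * ((ln (LR_stat n p (\<lambda>i j. x (i, j))) - mu_LR n p) / s)
          = - (?u * mu_LR n p) + ?u * (real n * real p / 2 * (1 - ln (real n))) + ?v * ln (?det x)
            + - (?u * ((\<Sum>k\<in>{..<n} \<times> {..<p}. (x k)\<^sup>2) / 2))"
      proof -
        have "t * ((a + h * b - c - m) / s) = - (?u * m) + ?u * a + ?u * h * b + - (?u * c)" for a b c h m
          by (simp add: algebra_simps add_divide_distrib diff_divide_distrib)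
        then show ?thesis
          unfolding ln_LR_stat[OF n elim] \<open>(\<Sum>j<p. \<Sum>i<n. (x (i, j))\<^sup>2) = _\<close> .
      qed
      then have "exp (\<i> * of_real (t * ((ln (LR_stat n p (\<lambda>i j. x (i, j))) - mu_LR n p) / s)))
          = ?c * exp (\<i> * of_real (?v * ln (?det x))) * ?e x"
        by (simp only: of_real_add of_real_minus distrib_left exp_add mult_minus_right mult_minus_left)
      moreover have "unit_powr ?v (gram_det n (Suc p) (augment x)) = unit_powr ?v (real n) * exp (\<i> * of_real (?v * ln (?det x)))"
      proof -
        have "unit_powr ?v (gram_det n (Suc p) (augment x)) = unit_powr ?v (real n) * unit_powr ?v (?det x)"
          using elim n by (simp only: gram_det_augment unit_powr_mult less_imp_le)
        then show ?thesis using elim by (simp only: unit_powr_def[of _ "?det x"] if_True)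
      qed
      moreover have "unit_powr ?v (real n) \<noteq> 0" using n by (simp add: unit_powr_def)
      ultimately show ?case by simp
    qed
  qed
  also have "\<dots> = ?c / unit_powr ?v (real n) * (unit_powr ?v (real n) * (\<Prod>d\<in>{1..p}. chisq_factor n d ?v ?u))"
    using np s by (subst integral_mult_right_zero, subst integral_gauss_gram_det) auto
  also have "\<dots> = ?c * (\<Prod>d\<in>{1..p}. chisq_factor n d ?v ?u)"
    using n by (simp add: unit_powr_def)
  also have "\<dots> = exp (log_char n p (of_real ?u))"
    by (rule prod_chisq_factor_eq_exp_log_char[OF np])
  finally show ?thesis .
qed

text \<open>Independence and normality make the restricted family of entries distributed as the
  Gaussian product measure, and the statistic depends on these entries only. With 0 < p the index
  set is nonempty, as the characterisation of independence by product laws demands.\<close>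

lemma char_standardized_LR_stat:
  assumes M: "prob_space M" and np: "p + 1 < n" "0 < p" and s: "s \<noteq> 0" "\<bar>t / s\<bar> < 1"
    and indep: "prob_space.indep_vars M (\<lambda>_. borel) (\<lambda>(i, j). X i j) ({..<n} \<times> {..<p})"
    and normal: "\<And>i j. i < n \<Longrightarrow> j < p \<Longrightarrow> distributed M lborel (X i j) std_normal_density"
  shows "char (distr M borel (\<lambda>\<omega>. (ln (LR_stat n p (\<lambda>i j. X i j \<omega>)) - mu_LR n p) / s)) t
       = exp (log_char n p (of_real (t / s)))"
proof -
  interpret prob_space M by fact
  let ?I = "{..<n} \<times> {..<p}"
  let ?Y = "\<lambda>k::nat \<times> nat. case k of (i, j) \<Rightarrow> X i j"
  let ?W = "\<lambda>\<omega>. \<lambda>k\<in>?I. ?Y k \<omega>"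
  let ?F = "\<lambda>x. exp (\<i> * complex_of_real (t * ((ln (LR_stat n p (\<lambda>i j. x (i, j))) - mu_LR n p) / s)))"
  have rv: "X i j \<in> borel_measurable M" if "i < n" "j < p" for i j
    using distributed_measurable[OF normal[OF that]] by simp
  have Y: "?Y k \<in> borel_measurable M" if "k \<in> ?I" for k
    using that rv by auto
  have law: "distr M borel (?Y k) = std_normal_distribution" if k_in: "k \<in> ?I" for k
  proof -
    obtain i j where k: "k = (i, j)" "i < n" "j < p" using k_in by auto
    have "distr M borel (X i j) = distr M lborel (X i j)" by (intro distr_cong) auto
    then show ?thesis
      using normal[OF k(2,3)] k(1) by (simp add: distributed_def)
  qed
  have sets: "sets (\<Pi>\<^sub>M k\<in>?I. borel) = sets (gauss ?I)"
    by (intro sets_PiM_cong) auto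
  have "distr M (gauss ?I) ?W = distr M (\<Pi>\<^sub>M k\<in>?I. borel) ?W"
    using sets by (intro distr_cong) auto
  also have "\<dots> = (\<Pi>\<^sub>M k\<in>?I. distr M borel (?Y k))"
    using np indep Y by (subst indep_vars_iff_distr_eq_PiM'[symmetric]) auto
  also have "\<dots> = gauss ?I"
    using law by (intro PiM_cong) auto
  finally have W: "distr M (gauss ?I) ?W = gauss ?I" .
  have W_meas: "?W \<in> measurable M (gauss ?I)"
    using Y by (intro measurable_restrict) auto
  have F: "?F \<in> borel_measurable (gauss ?I)"
  proof -
    have "(\<lambda>x. LR_stat n p (\<lambda>i j. x (i, j))) \<in> borel_measurable (gauss ?I)"
      by (intro measurable_LR_stat measurable_gauss_component) auto
    then show ?thesis by measurable
  qed
  have LR: "(\<lambda>\<omega>. LR_stat n p (\<lambda>i j. X i j \<omega>)) \<in> borel_measurable M"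
    by (intro measurable_LR_stat rv)
  have "char (distr M borel (\<lambda>\<omega>. (ln (LR_stat n p (\<lambda>i j. X i j \<omega>)) - mu_LR n p) / s)) t
      = (\<integral>\<omega>. exp (\<i> * of_real (t * ((ln (LR_stat n p (\<lambda>i j. X i j \<omega>)) - mu_LR n p) / s))) \<partial>M)"
    unfolding char_def using LR by (subst integral_distr) auto
  also have "\<dots> = (\<integral>\<omega>. ?F (?W \<omega>) \<partial>M)"
  proof (intro Bochner_Integration.integral_cong refl)
    fix \<omega>
    have "LR_stat n p (\<lambda>i j. X i j \<omega>) = LR_stat n p (\<lambda>i j. ?W \<omega> (i, j))"
      by (rule LR_stat_cong) auto
    then show "exp (\<i> * of_real (t * ((ln (LR_stat n p (\<lambda>i j. X i j \<omega>)) - mu_LR n p) / s))) = ?F (?W \<omega>)"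
      by (simp only:)
  qed
  also have "\<dots> = (\<integral>x. ?F x \<partial>gauss ?I)"
    using integral_distr[OF W_meas F] unfolding W by (rule sym)
  also have "\<dots> = exp (log_char n p (of_real (t / s)))"
    by (rule integral_gauss_exp_LR_stat[OF np(1) s])
  finally show ?thesis .
qed

text \<open>Under the null hypothesis all coordinates of all observations are independent standard
  normal, which is how the sample is modelled. Each n may have its own sample, since weak
  convergence sees only the law of each statistic.\<close>

theorem theorem5:
  fixes M :: "'a measure" and p :: "nat \<Rightarrow> nat" and y :: real
    and X :: "nat \<Rightarrow> nat \<Rightarrow> nat \<Rightarrow> 'a \<Rightarrow> real"
  assumes "prob_space M"
    and "\<forall>n\<ge>3. real n > 1 + real (p n)"
    and "(\<lambda>n. real (p n) / real n) \<longlonglongrightarrow> y" and "0 < y" and "y \<le> 1"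
    and "\<forall>n. prob_space.indep_vars M (\<lambda>_. borel) (\<lambda>(i, j). X n i j) ({..<n} \<times> {..<p n})"
    and "\<forall>n i j. i < n \<longrightarrow> j < p n \<longrightarrow> distributed M lborel (X n i j) std_normal_density"
  shows "weak_conv_m
     (\<lambda>n. distr M borel (\<lambda>\<omega>. (ln (LR_stat n (p n) (\<lambda>i j. X n i j \<omega>)) - mu_LR n (p n))
                               / (real n * sqrt (sigma2_LR n (p n)))))
     std_normal_distribution"
proof (rule levy_continuity)
  interpret prob_space M by fact
  let ?s = "\<lambda>n. real n * sqrt (sigma2_LR n (p n))"
  let ?T = "\<lambda>n \<omega>. (ln (LR_stat n (p n) (\<lambda>i j. X n i j \<omega>)) - mu_LR n (p n)) / ?s n"
  have p_less: "p n + 1 < n" if "3 \<le> n" for n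
    using assms(2) that by force
  show "real_distribution (distr M borel (?T n))" for n
  proof -
    have "(\<lambda>\<omega>. LR_stat n (p n) (\<lambda>i j. X n i j \<omega>)) \<in> borel_measurable M"
      using assms(7) distributed_measurable by (intro measurable_LR_stat) fastforce
    then show ?thesis
      by (intro real_distribution_distr borel_measurable_divide borel_measurable_diff borel_measurable_ln borel_measurable_const)
  qed
  show "real_distribution std_normal_distribution"
    by (rule real_dist_normal_dist)
  fix t :: real
  have "(\<lambda>n. exp (log_char n (p n) (of_real (t / ?s n)))) \<longlonglongrightarrow> exp (of_real (- t\<^sup>2 / 2))"
    using p_less assms(3-5) by (intro tendsto_exp tendsto_log_char)
  \<comment> \<open>The formula is available for large n only: p > 0, sigma > 0 and a small argument
    are all consequences of the limit y > 0.\<close>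
  moreover have "\<forall>\<^sub>F n in sequentially. exp (log_char n (p n) (of_real (t / ?s n))) = char (distr M borel (?T n)) t"
  proof -
    have "\<forall>\<^sub>F n in sequentially. 0 < real (p n) / real n"
      using assms(3,4) by (rule order_tendstoD(1))
    moreover have "\<forall>\<^sub>F n in sequentially. y / 4 \<le> sqrt (sigma2_LR n (p n))"
      using p_less assms(3-5) by (rule eventually_sigma_ge)
    moreover have "\<forall>\<^sub>F n in sequentially. \<bar>t / ?s n\<bar> < 1"
      using p_less assms(3-5) by (rule eventually_argument_small)
    ultimately show ?thesis
      using eventually_ge_at_top[of 3]
    proof eventually_elim
      case (elim n)
      have "0 < sqrt (sigma2_LR n (p n))" using elim(2) \<open>0 < y\<close> by linarith
      then have "?s n \<noteq> 0" using elim(4) by simp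
      moreover have "0 < p n" using elim(1) by (cases "p n = 0") auto
      ultimately show ?case
        using assms(1,6,7) p_less[OF elim(4)] elim(3) by (intro char_standardized_LR_stat[symmetric]) auto
    qed
  qed
  ultimately have "(\<lambda>n. char (distr M borel (?T n)) t) \<longlonglongrightarrow> exp (of_real (- t\<^sup>2 / 2))"
    by (rule Lim_transform_eventually)
  then show "(\<lambda>n. char (distr M borel (?T n)) t) \<longlonglongrightarrow> char std_normal_distribution t"
    by (simp only: char_std_normal_distribution exp_of_real)
qed

end
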